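(* Let $k$ be a field of characteristic zero, $R=k[x_1,\ldots,x_n]$, let $\mathbf f=f_1,\ldots,f_m\in R$ be $k$-linearly independent forms of degree $2$, and set $A=k[\mathbf f]\simeq k[T_1,\ldots,T_m]/P$ via $T_j\mapsto f_j$. Assume that: (a) $P$ is minimally generated by forms of degree $2$; (b) the homological dimension of $\mathcal{D}(\mathbf f)$ over $R$ is at most one. Then $A$ is a polarizable complete intersection; that is, $\mathbf f$ is polarizable and $P$ is generated by a regular sequence.
   Context: Homological dimension means projective dimension. For $f\in R$ put $df=\sum_{i=1}^n\frac{\partial f}{\partial x_i}dx_i$ in the free $R$-module $\sum_{i=1}^n R\,dx_i$. The transposed Jacobian module is $\mathcal{D}(\mathbf f)=\sum_{j=1}^m R\,df_j$. The differential syzygy module $\mathfrak{Z}$ is the kernel of the $R$-linear map $\sum_{j=1}^m R\,dT_j\to\mathcal{D}(\mathbf f)$, $dT_j\mapsto df_j$, where $\sum_j R\,dT_j$ is free with basis $dT_1,\ldots,dT_m$. The polar syzygy module $\mathfrak{D}\subset\mathfrak{Z}$ is the $R$-submodule generated by the vectors $\sum_{j=1}^m\frac{\partial F}{\partial T_j}(\mathbf f)\,dT_j$, $F\in P$. $\mathbf f$ (or the embedding $A\subset R$) is polarizable if $\mathfrak{D}=\mathfrak{Z}$. *)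

theory Defs
  imports "HOL-Analysis.Cartesian_Space" "HOL-Library.Poly_Mapping" "HOL-Library.Extended_Nat"
begin

section \<open>Polynomials in finitely many variables\<close>

text \<open>
  The polynomial ring over \<open>'k\<close> with variables indexed by a type \<open>'v\<close> (finite, below)
  is the monoid ring of the exponent vectors \<open>'v \<Rightarrow>\<^sub>0 nat\<close>.
\<close>

type_synonym ('v, 'k) mpoly = "('v \<Rightarrow>\<^sub>0 nat) \<Rightarrow>\<^sub>0 'k"

definition const :: "'k::zero \<Rightarrow> ('v, 'k) mpoly" where
  "const c = Poly_Mapping.single 0 c"

text \<open>A form of degree \<open>d\<close> is a homogeneous polynomial; the zero polynomial is a form of every degree.\<close>

definition is_form :: "nat \<Rightarrow> ('v, 'k::zero) mpoly \<Rightarrow> bool" where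
  "is_form d p \<longleftrightarrow> (\<forall>t\<in>Poly_Mapping.keys p.
     (\<Sum>i\<in>Poly_Mapping.keys t. Poly_Mapping.lookup t i) = d)"

text \<open>
  The exponent subtraction is truncated, but where truncation occurs the coefficient is zero.
\<close>

definition partial_deriv :: "'v \<Rightarrow> ('v, 'k::comm_semiring_1) mpoly \<Rightarrow> ('v, 'k) mpoly" where
  "partial_deriv i p = (\<Sum>t\<in>Poly_Mapping.keys p.
     Poly_Mapping.single (t - Poly_Mapping.single i 1)
       (of_nat (Poly_Mapping.lookup t i) * Poly_Mapping.lookup p t))"

text \<open>The value \<open>F(f)\<close>, i.e. the image of \<open>F\<close> under the \<open>'k\<close>-algebra map sending \<open>T\<^sub>j\<close> to \<open>f j\<close>.\<close>

definition poly_subst ::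
    "('m::finite \<Rightarrow> ('v, 'k::comm_ring_1) mpoly) \<Rightarrow> ('m, 'k) mpoly \<Rightarrow> ('v, 'k) mpoly" where
  "poly_subst f F = (\<Sum>t\<in>Poly_Mapping.keys F.
     const (Poly_Mapping.lookup F t) * (\<Prod>j\<in>UNIV. f j ^ Poly_Mapping.lookup t j))"


section \<open>Ideals and regular sequences\<close>

lemma module_mult: "module ((*) :: 'r::comm_ring_1 \<Rightarrow> 'r \<Rightarrow> 'r)"
  by unfold_locales (simp_all add: algebra_simps)

lemma module_vec: "module ((*s) :: 'r::comm_ring_1 \<Rightarrow> 'r ^ 'n \<Rightarrow> 'r ^ 'n)"
  by unfold_locales (simp_all add: vec_eq_iff algebra_simps)

definition gen_ideal :: "'r::comm_ring_1 set \<Rightarrow> 'r set" where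
  "gen_ideal S = module.span (*) S"

definition regular_sequence :: "'r::comm_ring_1 list \<Rightarrow> bool" where
  "regular_sequence gs \<longleftrightarrow> gen_ideal (set gs) \<noteq> UNIV \<and>
     (\<forall>i<length gs. \<forall>h. gs ! i * h \<in> gen_ideal (set (take i gs))
        \<longrightarrow> h \<in> gen_ideal (set (take i gs)))"

definition minimally_generates :: "'r::comm_ring_1 set \<Rightarrow> 'r set \<Rightarrow> bool" where
  "minimally_generates G I \<longleftrightarrow>
     finite G \<and> gen_ideal G = I \<and> (\<forall>H. H \<subset> G \<longrightarrow> gen_ideal H \<noteq> I)"


section \<open>Homological dimension\<close>

text \<open>
  Modules are subsets \<open>M\<close> of an ambient type, closed under addition and the scalar
  multiplication \<open>s\<close>; homomorphisms are only constrained on these carriers.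
\<close>

definition hom_on ::
    "('r \<Rightarrow> 'a::ab_group_add \<Rightarrow> 'a) \<Rightarrow> ('r \<Rightarrow> 'b::ab_group_add \<Rightarrow> 'b) \<Rightarrow> 'a set \<Rightarrow> 'b set
      \<Rightarrow> ('a \<Rightarrow> 'b) \<Rightarrow> bool" where
  "hom_on s s' M N h \<longleftrightarrow> h ` M \<subseteq> N \<and> (\<forall>x\<in>M. \<forall>y\<in>M. h (x + y) = h x + h y) \<and>
     (\<forall>c. \<forall>x\<in>M. h (s c x) = s' c (h x))"

text \<open>Scalar multiplication of the free module \<open>'i \<Rightarrow>\<^sub>0 'r\<close> with basis \<open>'i\<close>.\<close>

definition free_scale :: "'r::comm_ring_1 \<Rightarrow> ('i \<Rightarrow>\<^sub>0 'r) \<Rightarrow> ('i \<Rightarrow>\<^sub>0 'r)" where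
  "free_scale c = Poly_Mapping.map ((*) c)"

lemma lookup_free_scale [simp]:
  "Poly_Mapping.lookup (free_scale c p) i = c * Poly_Mapping.lookup p i"
  by (simp add: free_scale_def Poly_Mapping.map.rep_eq when_def)

lemma module_free_scale: "module (free_scale :: 'r::comm_ring_1 \<Rightarrow> ('i \<Rightarrow>\<^sub>0 'r) \<Rightarrow> _)"
  by unfold_locales (auto intro!: poly_mapping_eqI simp: lookup_add algebra_simps)

text \<open>
  Projective: a direct summand of a free module. Taking the ambient type itself as index set of
  the basis loses nothing: if \<open>M\<close> is a direct summand of some free module, then the
  canonical map onto \<open>M\<close> from the free module on (a superset of) \<open>M\<close> splits.
\<close>

definition projective ::
    "('r::comm_ring_1 \<Rightarrow> 'b::ab_group_add \<Rightarrow> 'b) \<Rightarrow> 'b set \<Rightarrow> bool" where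
  "projective s M \<longleftrightarrow> module.subspace s M \<and>
     (\<exists>(\<iota> :: 'b \<Rightarrow> ('b \<Rightarrow>\<^sub>0 'r)) \<pi>.
        hom_on s free_scale M UNIV \<iota> \<and> hom_on free_scale s UNIV M \<pi> \<and> (\<forall>x\<in>M. \<pi> (\<iota> x) = x))"

text \<open>
  An exact complex \<open>0 \<rightarrow> P d \<rightarrow> \<dots> \<rightarrow> P 1 \<rightarrow> P 0 \<rightarrow> M \<rightarrow> 0\<close> of projective modules, with maps
  \<open>\<delta> i : P (i + 1) \<rightarrow> P i\<close> and \<open>\<epsilon> : P 0 \<rightarrow> M\<close>; the \<open>P i\<close> with \<open>i > d\<close> are zero.
\<close>

definition projective_resolution ::
    "('r::comm_ring_1 \<Rightarrow> 'p::ab_group_add \<Rightarrow> 'p) \<Rightarrow> ('r \<Rightarrow> 'b::ab_group_add \<Rightarrow> 'b) \<Rightarrow> nat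
      \<Rightarrow> (nat \<Rightarrow> 'p set) \<Rightarrow> (nat \<Rightarrow> 'p \<Rightarrow> 'p) \<Rightarrow> ('p \<Rightarrow> 'b) \<Rightarrow> 'b set \<Rightarrow> bool" where
  "projective_resolution sP s d P \<delta> \<epsilon> M \<longleftrightarrow>
     (\<forall>i. projective sP (P i)) \<and> (\<forall>i>d. P i = {0}) \<and>
     hom_on sP s (P 0) M \<epsilon> \<and> (\<forall>i. hom_on sP sP (P (Suc i)) (P i) (\<delta> i)) \<and>
     \<epsilon> ` P 0 = M \<and>
     {x \<in> P 0. \<epsilon> x = 0} = \<delta> 0 ` P 1 \<and>
     (\<forall>i. {x \<in> P (Suc i). \<delta> i x = 0} = \<delta> (Suc i) ` P (Suc (Suc i)))"

text \<open>
  The least length of a projective resolution (\<open>\<infinity>\<close> if there is no finite one). HOL cannot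
  quantify over the type carrying the resolution, so one large enough type is fixed: a
  free module on \<open>nat \<times> 'r \<times> 'b\<close>. Every \<open>'r\<close>-module \<open>M\<close> in \<open>'b\<close> has a free resolution by modules
  on at most \<open>|nat \<times> 'r \<times> 'b|\<close> generators; if a resolution of length \<open>d\<close> exists anywhere, then
  by Schanuel's lemma the \<open>d\<close>-th syzygy module (\<open>M\<close> itself for \<open>d = 0\<close>) of this free resolution is
  projective, so truncating it there gives one of length \<open>d\<close> that embeds in the chosen type.
\<close>

definition homological_dimension ::
    "('r::comm_ring_1 \<Rightarrow> 'b::ab_group_add \<Rightarrow> 'b) \<Rightarrow> 'b set \<Rightarrow> enat" where
  "homological_dimension s M = Inf {enat d | d.
     \<exists>(P :: nat \<Rightarrow> ((nat \<times> 'r \<times> 'b) \<Rightarrow>\<^sub>0 'r) set) \<delta> \<epsilon>.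
       projective_resolution free_scale s d P \<delta> \<epsilon> M}"


section \<open>Polar and differential syzygies\<close>

text \<open>
  The free modules \<open>\<Sum> R dx\<^sub>i\<close> and \<open>\<Sum> R dT\<^sub>j\<close> are \<open>R ^ 'n\<close> and \<open>R ^ 'm\<close>.
\<close>

definition differential ::
    "('n::finite, 'k::comm_ring_1) mpoly \<Rightarrow> ('n, 'k) mpoly ^ 'n" where
  "differential p = (\<chi> i. partial_deriv i p)"

context
  fixes f :: "'m::finite \<Rightarrow> ('n::finite, 'k::comm_ring_1) mpoly"
begin

definition relation_ideal :: "('m, 'k) mpoly set" where
  "relation_ideal = {F. poly_subst f F = 0}"

definition transposed_jacobian_module :: "(('n, 'k) mpoly ^ 'n) set" where
  "transposed_jacobian_module = module.span (*s) ((\<lambda>j. differential (f j)) ` UNIV)"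

definition differential_syzygies :: "(('n, 'k) mpoly ^ 'm) set" where
  "differential_syzygies = {v. (\<Sum>j\<in>UNIV. (v $ j) *s differential (f j)) = 0}"

definition polar_syzygies :: "(('n, 'k) mpoly ^ 'm) set" where
  "polar_syzygies = module.span (*s)
     {(\<chi> j. poly_subst f (partial_deriv j F)) | F. F \<in> relation_ideal}"

definition polarizable :: bool where
  "polarizable \<longleftrightarrow> polar_syzygies = differential_syzygies"

end

end

theory Submission
  imports Defs "HOL-Analysis.Determinants"
begin

text \<open>
  Let \<open>F\<^sub>1, \<dots>, F\<^sub>r\<close> be the quadrics of a minimal generating set of the relation ideal \<open>P\<close>, and let
  \<open>v\<^sub>i = \<Sum>\<^sub>j \<partial>F\<^sub>i/\<partial>T\<^sub>j(f) dT\<^sub>j\<close>. By the product rule the \<open>v\<^sub>i\<close> generate the polar syzygies. Two things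
  decide the theorem: the degrees of syzygies, and characteristic zero.

  \<^emph>\<open>Polarizability.\<close> Euler's formula turns a syzygy \<open>z\<close> of the differentials into a relation
  \<open>\<Sum>\<^sub>j z\<^sub>j f\<^sub>j = 0\<close>; together with its derivatives and the linear independence of the quadrics \<open>f\<^sub>j\<close>
  this excludes syzygies of degree 0 and 1 (\<open>order_syzygies\<close>). The \<open>v\<^sub>i\<close> have degree 2, the
  smallest possible, and are linearly independent over \<open>k\<close>, so they are part of a minimal
  generating set of the module \<open>Z\<close> of all differential syzygies. As the transposed Jacobian
  module has homological dimension at most one, \<open>Z\<close> is projective (\<open>syzygy_in_trace_span\<close>), and a
  minimal generating set of a graded projective module is a basis. What is needed of this is
  that there are linear functionals \<open>\<phi>\<^sub>l\<close> on \<open>Z\<close> for which \<open>\<phi>\<^sub>l(v\<^sub>i)\<close> has constant coefficient 1 if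
  \<open>i = l\<close> and 0 otherwise (\<open>ex_dual_functionals\<close>). In characteristic zero the polar syzygies have
  the same rank as \<open>Z\<close>, by the Jacobian criterion (\<open>polar_syzygies_full_rank\<close>). So every \<open>z \<in> Z\<close>
  has a nonzero multiple in the span of the \<open>v\<^sub>i\<close>, and comparing lowest coefficients under the \<open>\<phi>\<^sub>l\<close>
  shows that \<open>z\<close> itself lies in it (\<open>form_syzygy_in_polar\<close>).

  \<^emph>\<open>Complete intersection.\<close> The functionals also show that the \<open>v\<^sub>i\<close> are linearly independent over \<open>R\<close>.
  This means that the Jacobian matrix of \<open>F\<^sub>1, \<dots>, F\<^sub>r\<close> has rank \<open>r\<close> modulo the prime ideal \<open>P\<close>, so
  elimination without division (\<open>prime_elimination\<close>) gives derivations \<open>\<delta>\<^sub>l\<close> of \<open>k[T]\<close> and some \<open>\<Delta> \<notin> P\<close>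
  with \<open>\<delta>\<^sub>l F\<^sub>i = \<Delta>\<close> for \<open>i = l\<close> and \<open>\<delta>\<^sub>l F\<^sub>i = 0\<close> otherwise. Differentiating with them shows that
  \<open>F\<^sub>i h \<in> J\<^sub>i\<close>, where \<open>J\<^sub>i\<close> is generated by the earlier generators, forces \<open>h \<in> J\<^sub>i + P\<^sup>n\<close> for
  every \<open>n\<close> (\<open>quasi_regular\<close>). Since all \<open>F\<^sub>i\<close> are forms of positive degree, \<open>h \<in> J\<^sub>i\<close> follows
  degree by degree.
\<close>

section \<open>Linear algebra over commutative rings\<close>

interpretation ideal: module "(*) :: 'r::comm_ring_1 \<Rightarrow> 'r \<Rightarrow> 'r"
  by (rule module_mult)

text \<open>
  Oriented from left to right, this rule associates products to the left and so works against
  the normal form in which the ring simplification rules leave them.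
\<close>

declare ideal.scale_scale [simp del]

interpretation rvec: module "(*s) :: 'r::comm_ring_1 \<Rightarrow> 'r ^ 'n \<Rightarrow> 'r ^ 'n"
  by (rule module_vec)

interpretation free: module "free_scale :: 'r::comm_ring_1 \<Rightarrow> ('i \<Rightarrow>\<^sub>0 'r) \<Rightarrow> ('i \<Rightarrow>\<^sub>0 'r)"
  by (rule module_free_scale)

lemma (in module) span_image_coordinates:
  assumes "finite I" "x \<in> span (d ` I)"
  shows "\<exists>a. x = (\<Sum>i\<in>I. scale (a i) (d i))"
  using assms(2)
proof (induction rule: span_induct_alt)
  case base
  show ?case by (rule exI[of _ "\<lambda>_. 0"]) simp
next
  case (step c x y)
  then obtain a i where a: "y = (\<Sum>i\<in>I. scale (a i) (d i))" and i: "i \<in> I" "x = d i" by auto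
  have "(\<Sum>l\<in>I. scale (if l = i then c else 0) (d l)) = (\<Sum>l\<in>I. if l = i then scale c (d l) else 0)"
    by (intro sum.cong) auto
  also have "\<dots> = scale c x" using i assms(1) by simp
  finally have "(\<Sum>l\<in>I. scale ((if l = i then c else 0) + a l) (d l)) = scale c x + y"
    unfolding a by (simp only: scale_left_distrib sum.distrib)
  then show ?case by metis
qed

text \<open>
  Gaussian elimination without division. The elements of \<open>V\<close> are the columns of a matrix with \<open>r\<close>
  rows, closed under linear combinations, and \<open>Q\<close> stands for a prime ideal. If the rows are
  linearly independent modulo \<open>Q\<close>, then columns can be combined to \<open>\<Delta>\<close> times the unit matrix. In the
  induction step the last row, reduced by the others, has an entry outside \<open>Q\<close> by independence,
  and this entry serves as pivot.

  The lemma is used twice: over a field with \<open>Q = {0}\<close>, and over a polynomial ring with a relation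
  ideal.
\<close>

lemma prime_elimination:
  fixes V :: "(nat \<Rightarrow> 'a::comm_ring_1) set" and Q :: "'a set"
  assumes Q0: "0 \<in> Q" and Q1: "1 \<notin> Q" and Qm: "\<And>a b. a * b \<in> Q \<Longrightarrow> a \<in> Q \<or> b \<in> Q"
    and V: "\<And>x y a b. x \<in> V \<Longrightarrow> y \<in> V \<Longrightarrow> (\<lambda>i. a * x i + b * y i) \<in> V"
    and indep: "\<And>c. (\<And>x. x \<in> V \<Longrightarrow> (\<Sum>i<r. c i * x i) \<in> Q) \<Longrightarrow> \<forall>i<r. c i \<in> Q"
  shows "\<exists>\<Delta>. \<Delta> \<notin> Q \<and> (\<exists>B. \<forall>l<r. B l \<in> V \<and> (\<forall>i<r. B l i = (if i = l then \<Delta> else 0)))"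
  using indep
proof (induction r)
  case 0
  then show ?case using Q1 by auto
next
  case (Suc r)
  have "\<forall>i<r. c i \<in> Q" if "\<And>x. x \<in> V \<Longrightarrow> (\<Sum>i<r. c i * x i) \<in> Q" for c
  proof -
    have eq: "(\<Sum>i<Suc r. (c(r := 0)) i * x i) = (\<Sum>i<r. c i * x i)" for x
      by simp
    have "\<forall>i<Suc r. (c(r := 0)) i \<in> Q"
      by (rule Suc.prems) (unfold eq, rule that)
    then show ?thesis
    proof (intro allI impI)
      fix i assume "\<forall>i<Suc r. (c(r := 0)) i \<in> Q" "i < r"
      then have "(c(r := 0)) i \<in> Q" using less_SucI by blast
      then show "c i \<in> Q" using \<open>i < r\<close> by simp
    qed
  qed
  then obtain \<Delta> B where \<Delta>: "\<Delta> \<notin> Q" and B: "\<And>l. l < r \<Longrightarrow> B l \<in> V"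
    and Bi: "\<And>l i. l < r \<Longrightarrow> i < r \<Longrightarrow> B l i = (if i = l then \<Delta> else 0)"
    using Suc.IH by blast
  have comb: "(\<lambda>i. a * x i - (\<Sum>l<n. c l * B l i)) \<in> V" if "x \<in> V" "n \<le> r" for a x c n
    using that(2)
  proof (induction n)
    case 0
    then show ?case using V[OF that(1) that(1), of a 0] by simp
  next
    case (Suc n)
    then have "(\<lambda>i. a * x i - (\<Sum>l<n. c l * B l i)) \<in> V" "B n \<in> V" by (auto simp: B)
    from V[OF this, of 1 "- c n"] show ?case by (simp add: algebra_simps)
  qed
  \<comment> \<open>the entry in column \<open>x\<close> of the last row after reduction by the other rows\<close>
  define w where "w x = \<Delta> * x r - (\<Sum>l<r. x l * B l r)" for x :: "nat \<Rightarrow> 'a"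
  have "\<exists>x\<in>V. w x \<notin> Q"
  proof (rule ccontr)
    assume neg: "\<not> (\<exists>x\<in>V. w x \<notin> Q)"
    define c where "c i = (if i = r then \<Delta> else - B i r)" for i
    have "(\<Sum>i<Suc r. c i * x i) = w x" for x
      by (simp add: c_def w_def sum_negf mult.commute)
    then have "\<forall>i<Suc r. c i \<in> Q" using neg Suc.prems[of c] by auto
    then have "c r \<in> Q" by blast
    then show False using \<Delta> by (simp add: c_def)
  qed
  then obtain x where x: "x \<in> V" and wx: "w x \<notin> Q" by blast
  define y where "y = (\<lambda>i. \<Delta> * x i - (\<Sum>l<r. x l * B l i))"
  have y: "y \<in> V" unfolding y_def using comb[OF x, of r] by simp
  have yr: "y r = w x" by (simp add: y_def w_def)
  have yi: "y i = 0" if "i < r" for i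
  proof -
    have "(\<Sum>l<r. x l * B l i) = (\<Sum>l<r. if l = i then x l * \<Delta> else 0)"
      using that by (intro sum.cong) (auto simp: Bi)
    then show ?thesis using that by (simp add: y_def mult.commute)
  qed
  define B' where "B' l = (if l = r then (\<lambda>i. \<Delta> * y i + 0 * y i) else (\<lambda>i. w x * B l i + (- B l r) * y i))" for l
  have "\<forall>l<Suc r. B' l \<in> V \<and> (\<forall>i<Suc r. B' l i = (if i = l then \<Delta> * w x else 0))"
  proof (intro allI impI conjI)
    fix l assume l: "l < Suc r"
    show "B' l \<in> V"
    proof (cases "l = r")
      case True
      show ?thesis unfolding B'_def if_P[OF True] by (rule V[OF y y])
    next
      case False
      then have "B l \<in> V" using l B by simp
      then show ?thesis unfolding B'_def if_not_P[OF False] by (rule V[OF _ y])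
    qed
    fix i assume i: "i < Suc r"
    show "B' l i = (if i = l then \<Delta> * w x else 0)"
      using l i by (auto simp: B'_def yr yi Bi less_Suc_eq)
  qed
  moreover have "\<Delta> * w x \<notin> Q" using Qm \<Delta> wx by blast
  ultimately show ?case by blast
qed

section \<open>Polynomial rings\<close>

abbreviation "coeff_at \<equiv> Poly_Mapping.lookup"
abbreviation "monom \<equiv> Poly_Mapping.single"

definition var :: "'v \<Rightarrow> ('v, 'k::zero_neq_one) mpoly" where
  "var i = monom (monom i 1) 1"

lemma const_zero [simp]: "const 0 = 0" by (simp add: const_def)
lemma const_one [simp]: "const 1 = 1" by (simp add: const_def)
lemma const_add: "const (a + b) = const a + const b" by (simp add: const_def single_add)
lemma const_mult: "const (a * b) = const a * const b" by (simp add: const_def mult_single)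
lemma const_of_nat: "const (of_nat n) = of_nat n" by (simp add: const_def)

lemma lookup_const_mult [simp]:
  "coeff_at (const c * p :: ('v, 'k::comm_ring_1) mpoly) t = c * coeff_at p t"
  unfolding const_def mult_map_scale_conv_mult[symmetric] free_scale_def[symmetric]
  by (rule lookup_free_scale)

lemma const_eq_0_iff [simp]: "const c = 0 \<longleftrightarrow> c = 0"
  by (metis const_def const_zero lookup_single_eq)

lemma mpoly_eq_sum_monoms:
  "(p :: 'a \<Rightarrow>\<^sub>0 'b::comm_monoid_add) = (\<Sum>t\<in>Poly_Mapping.keys p. monom t (coeff_at p t))"
  by (rule poly_mapping_eqI) (auto simp: lookup_sum lookup_single when_def in_keys_iff)

lemma mpoly_monom_induct [case_names monom add]:
  assumes "\<And>t c. Q (monom t c)" and "\<And>p q. Q p \<Longrightarrow> Q q \<Longrightarrow> Q (p + q)"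
  shows "Q (p :: ('v, 'k::comm_monoid_add) mpoly)"
proof -
  have "Q (\<Sum>t\<in>A. monom t (coeff_at p t))" if "finite A" for A
    using that
  proof induction
    case empty
    then show ?case using assms(1)[of 0 0] by simp
  qed (simp add: assms)
  then show ?thesis using mpoly_eq_sum_monoms[of p] finite_keys[of p] by metis
qed

lemma monom_eq_const_times: "monom t (c :: 'k::comm_semiring_1) = const c * monom t 1"
  by (simp add: const_def mult_single)

text \<open>
  Constants and variables generate the polynomial ring. Hence identities between ring
  homomorphisms or derivations need to be checked on these only.
\<close>

lemma mpoly_ring_induct [case_names const var add mult]:
  assumes c: "\<And>c. Q (const c)" and v: "\<And>i. Q (var i)"
    and a: "\<And>p q. Q p \<Longrightarrow> Q q \<Longrightarrow> Q (p + q)" and m: "\<And>p q. Q p \<Longrightarrow> Q q \<Longrightarrow> Q (p * q)"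
  shows "Q (p :: ('v, 'k::comm_ring_1) mpoly)"
proof (induction p rule: mpoly_monom_induct)
  have pow: "Q (monom (monom i n) 1)" for i :: 'v and n
  proof (induction n)
    case 0
    then show ?case using c[of 1] by (simp add: const_def)
  next
    case (Suc n)
    have "monom (monom i (Suc n)) 1 = var i * (monom (monom i n) 1 :: ('v, 'k) mpoly)"
      by (simp add: var_def mult_single flip: single_add)
    then show ?case using m[OF v Suc] by simp
  qed
  case (monom t b)
  have "Q (monom (\<Sum>i\<in>A. monom i (coeff_at t i)) 1)" if "finite A" for A
    using that
  proof induction
    case empty
    then show ?case using c[of 1] by (simp add: const_def)
  next
    case (insert x F)
    have "monom (\<Sum>i\<in>insert x F. monom i (coeff_at t i)) 1 =
      monom (monom x (coeff_at t x)) 1 * (monom (\<Sum>i\<in>F. monom i (coeff_at t i)) 1 :: ('v, 'k) mpoly)"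
      using insert by (simp add: mult_single)
    then show ?case using m[OF pow insert.IH] by simp
  qed
  from this[OF finite_keys[of t]] have "Q (monom t 1)"
    unfolding mpoly_eq_sum_monoms[of t, symmetric] .
  from m[OF c[of b] this] show ?case
    unfolding monom_eq_const_times[of t b] .
qed (simp add: a)

lemma lookup_partial_deriv:
  "coeff_at (partial_deriv i p) t = of_nat (Suc (coeff_at t i)) * coeff_at p (t + monom i 1)"
proof -
  have eq: "s - monom i 1 = t \<longleftrightarrow> s = t + monom i 1" if "coeff_at s i \<noteq> 0" for s
  proof
    assume "s - monom i 1 = t"
    moreover have "s = s - monom i 1 + monom i 1"
      using that by (intro poly_mapping_eqI) (auto simp: lookup_add lookup_minus lookup_single when_def)
    ultimately show "s = t + monom i 1" by simp
  qed simp
  have "coeff_at (partial_deriv i p) t = (\<Sum>s\<in>Poly_Mapping.keys p.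
      if s = t + monom i 1 then of_nat (coeff_at s i) * coeff_at p s else 0)"
    unfolding partial_deriv_def lookup_sum
  proof (rule sum.cong)
    fix s
    show "coeff_at (monom (s - monom i 1) (of_nat (coeff_at s i) * coeff_at p s)) t =
      (if s = t + monom i 1 then of_nat (coeff_at s i) * coeff_at p s else 0)"
    proof (cases "coeff_at s i = 0")
      case True
      then have "s \<noteq> t + monom i 1" by (auto simp: lookup_add)
      then show ?thesis using True by simp
    next
      case False
      show ?thesis using eq[OF False] by (simp add: lookup_single when_def)
    qed
  qed simp
  also have "\<dots> = of_nat (Suc (coeff_at t i)) * coeff_at p (t + monom i 1)"
    by (auto simp: lookup_add in_keys_iff)
  finally show ?thesis .
qed

lemma partial_deriv_add: "partial_deriv i (p + q) = partial_deriv i p + partial_deriv i q"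
  by (rule poly_mapping_eqI) (simp add: lookup_partial_deriv lookup_add distrib_left del: of_nat_Suc)

lemma partial_deriv_0 [simp]: "partial_deriv i 0 = 0"
  by (rule poly_mapping_eqI) (simp add: lookup_partial_deriv)

lemma partial_deriv_const [simp]: "partial_deriv i (const c) = 0"
proof (rule poly_mapping_eqI)
  fix t
  have "0 \<noteq> t + monom i (1::nat)"
    by (metis add_eq_0_iff_both_eq_0 lookup_add lookup_single_eq lookup_zero zero_neq_one)
  then show "coeff_at (partial_deriv i (const c)) t = coeff_at 0 t"
    by (simp add: lookup_partial_deriv const_def lookup_single)
qed

lemma partial_deriv_monom:
  "partial_deriv i (monom t c) = monom (t - monom i 1) (of_nat (coeff_at t i) * c)"
  by (simp add: partial_deriv_def)

lemma partial_deriv_mult: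
  fixes p q :: "('v, 'k::comm_ring_1) mpoly"
  shows "partial_deriv i (p * q) = partial_deriv i p * q + p * partial_deriv i q"
proof (induction p rule: mpoly_monom_induct)
  case (monom s a)
  show ?case
  proof (induction q rule: mpoly_monom_induct)
    case (monom t b)
    have shift: "s - monom i 1 + t = s + t - monom i 1" if "coeff_at s i \<noteq> 0" for s t :: "'v \<Rightarrow>\<^sub>0 nat"
      using that by (intro poly_mapping_eqI) (auto simp: lookup_add lookup_minus lookup_single when_def)
    have 1: "partial_deriv i (monom s a) * monom t b = monom (s + t - monom i 1) (of_nat (coeff_at s i) * (a * b))"
      by (cases "coeff_at s i = 0") (simp_all add: partial_deriv_monom mult_single shift mult.assoc del: One_nat_def)
    have 2: "monom s a * partial_deriv i (monom t b) = monom (s + t - monom i 1) (of_nat (coeff_at t i) * (a * b))"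
      using shift[of t s]
      by (cases "coeff_at t i = 0") (simp_all add: partial_deriv_monom mult_single add.commute mult.left_commute del: One_nat_def)
    show ?case unfolding 1 2
      by (simp add: mult_single partial_deriv_monom lookup_add distrib_right flip: single_add)
  qed (simp add: partial_deriv_add distrib_left)
qed (simp add: partial_deriv_add distrib_right)

lemma partial_deriv_sum: "partial_deriv i (sum h A) = (\<Sum>a\<in>A. partial_deriv i (h a))"
  by (induction A rule: infinite_finite_induct) (auto simp: partial_deriv_add)

lemma partial_deriv_var: "partial_deriv i (var j) = (if i = j then 1 else 0)"
  by (auto simp: var_def partial_deriv_monom lookup_single)

lemma poly_subst_superset:
  assumes "finite A" "Poly_Mapping.keys F \<subseteq> A"
  shows "poly_subst f F = (\<Sum>t\<in>A. const (coeff_at F t) * (\<Prod>j\<in>UNIV. f j ^ coeff_at t j))"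
  unfolding poly_subst_def using assms
  by (intro sum.mono_neutral_left) (auto simp: in_keys_iff)

lemma poly_subst_0 [simp]: "poly_subst f 0 = 0" by (simp add: poly_subst_def)

lemma poly_subst_add: "poly_subst f (F + G) = poly_subst f F + poly_subst f G"
proof -
  let ?A = "Poly_Mapping.keys F \<union> Poly_Mapping.keys G"
  have "Poly_Mapping.keys (F + G) \<subseteq> ?A" by (rule keys_add)
  then show ?thesis
    by (simp add: poly_subst_superset[of ?A] lookup_add const_add distrib_right sum.distrib)
qed

lemma poly_subst_monom:
  "poly_subst f (monom t c) = const c * (\<Prod>j\<in>UNIV. f j ^ coeff_at t j)"
  by (simp add: poly_subst_def)

lemma poly_subst_mult: "poly_subst f (F * G) = poly_subst f F * poly_subst f G"
proof (induction F rule: mpoly_monom_induct)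
  case (monom s a)
  show ?case
  proof (induction G rule: mpoly_monom_induct)
    case (monom t b)
    show ?case
      by (simp add: mult_single poly_subst_monom const_mult lookup_add power_add prod.distrib mult_ac)
  qed (simp add: poly_subst_add distrib_left)
qed (simp add: poly_subst_add distrib_right)

lemma poly_subst_const [simp]: "poly_subst f (const c) = const c"
  by (simp add: const_def poly_subst_monom)

lemma poly_subst_1 [simp]: "poly_subst f 1 = 1"
  by (metis const_one poly_subst_const)

lemma poly_subst_var [simp]: "poly_subst f (var j) = f j"
proof -
  have "(\<Prod>i\<in>UNIV. f i ^ coeff_at (monom j 1) i) = (\<Prod>i\<in>UNIV. if i = j then f i else 1)"
    by (intro prod.cong) (auto simp: lookup_single)
  then show ?thesis by (simp add: var_def poly_subst_monom)
qed

lemma poly_subst_sum: "poly_subst f (sum h A) = (\<Sum>a\<in>A. poly_subst f (h a))"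
  by (induction A rule: infinite_finite_induct) (auto simp: poly_subst_add)

lemma poly_subst_poly_subst: "poly_subst f (poly_subst h F) = poly_subst (\<lambda>u. poly_subst f (h u)) F"
  by (induction F rule: mpoly_ring_induct) (simp_all add: poly_subst_add poly_subst_mult)

lemma poly_subst_id [simp]: "poly_subst var F = F"
  by (induction F rule: mpoly_ring_induct) (simp_all add: poly_subst_add poly_subst_mult)

lemma chain_rule:
  "partial_deriv i (poly_subst f F) = (\<Sum>j\<in>UNIV. poly_subst f (partial_deriv j F) * partial_deriv i (f j))"
proof (induction F rule: mpoly_ring_induct)
  case (var l)
  have "poly_subst f (partial_deriv j (var l)) * partial_deriv i (f j) =
     (if j = l then partial_deriv i (f j) else 0)" for j
    by (simp add: partial_deriv_var)
  then show ?case by simp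
next
  case (add p q)
  then show ?case by (simp add: poly_subst_add partial_deriv_add distrib_right sum.distrib)
next
  case (mult p q)
  then show ?case
    by (simp add: poly_subst_mult poly_subst_add partial_deriv_mult algebra_simps sum.distrib
        sum_distrib_left)
qed simp

text \<open>
  Comparing leading terms requires a linear order on exponent vectors. Renaming the variables
  injectively by natural numbers embeds the ring into one that has such an order.
\<close>

theorem mpoly_no_zero_divisors:
  fixes p q :: "('v::finite, 'k::idom) mpoly"
  assumes "p * q = 0"
  shows "p = 0 \<or> q = 0"
proof -
  obtain e :: "'v \<Rightarrow> nat" where e: "inj e"
    using finite_imp_inj_to_nat_seg[of "UNIV :: 'v set"] by auto
  define E where "E t = (\<Sum>v\<in>UNIV. monom (e v) (coeff_at t v))" for t :: "'v \<Rightarrow>\<^sub>0 nat"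
  have lookup_E: "coeff_at (E t) (e v) = coeff_at t v" for t v
  proof -
    have "coeff_at (E t) (e v) = (\<Sum>w\<in>UNIV. if w = v then coeff_at t w else 0)"
      unfolding E_def lookup_sum
      by (intro sum.cong) (auto simp: lookup_single when_def inj_eq[OF e])
    then show ?thesis by simp
  qed
  have inj_E: "E s = E t \<longleftrightarrow> s = t" for s t
    by (metis lookup_E poly_mapping_eqI)
  define \<Phi> where "\<Phi> = poly_subst (\<lambda>v. var (e v) :: (nat, 'k) mpoly)"
  have pow: "(monom (monom a 1) 1 :: (nat, 'k) mpoly) ^ n = monom (monom a n) 1" for a n
    by (induction n) (simp_all add: mult_single flip: single_add)
  have prodm: "(\<Prod>v\<in>A. monom (x v) 1 :: (nat, 'k) mpoly) = monom (\<Sum>v\<in>A. x v) 1"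
    for x :: "'v \<Rightarrow> nat \<Rightarrow>\<^sub>0 nat" and A
    by (induction A rule: infinite_finite_induct) (auto simp: mult_single)
  have \<Phi>_sum: "\<Phi> r = (\<Sum>t\<in>Poly_Mapping.keys r. monom (E t) (coeff_at r t))" for r
    unfolding \<Phi>_def poly_subst_def var_def pow prodm E_def
    by (simp add: const_def mult_single)
  have \<Phi>_lookup: "coeff_at (\<Phi> r) (E t) = coeff_at r t" for r t
    by (auto simp: \<Phi>_sum lookup_sum lookup_single when_def inj_E in_keys_iff)
  have \<Phi>_0: "\<Phi> r = 0 \<longleftrightarrow> r = 0" for r
    by (metis \<Phi>_def \<Phi>_lookup lookup_zero poly_mapping_eqI poly_subst_0)
  have "\<Phi> p * \<Phi> q = 0"
    using assms by (simp add: \<Phi>_def flip: poly_subst_mult)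
  then show ?thesis by (simp add: \<Phi>_0)
qed

lemma mpoly_mult_eq_0_iff [simp]:
  fixes p q :: "('v::finite, 'k::idom) mpoly"
  shows "p * q = 0 \<longleftrightarrow> p = 0 \<or> q = 0"
  using mpoly_no_zero_divisors by auto

section \<open>Homogeneous components and degrees\<close>

definition exp_deg :: "('v \<Rightarrow>\<^sub>0 nat) \<Rightarrow> nat" where
  "exp_deg t = (\<Sum>i\<in>Poly_Mapping.keys t. coeff_at t i)"

lemma is_form_iff: "is_form d p \<longleftrightarrow> (\<forall>t\<in>Poly_Mapping.keys p. exp_deg t = d)"
  by (simp add: is_form_def exp_deg_def)

lemma exp_deg_UNIV: "exp_deg (t :: 'v::finite \<Rightarrow>\<^sub>0 nat) = (\<Sum>i\<in>UNIV. coeff_at t i)"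
  unfolding exp_deg_def by (intro sum.mono_neutral_left) (auto simp: in_keys_iff)

lemma exp_deg_add [simp]: "exp_deg (s + t :: 'v::finite \<Rightarrow>\<^sub>0 nat) = exp_deg s + exp_deg t"
  by (simp add: exp_deg_UNIV lookup_add sum.distrib)

lemma exp_deg_single [simp]: "exp_deg (monom i n) = n"
  by (simp add: exp_deg_def)

lemma exp_deg_eq_0_iff [simp]: "exp_deg (t :: 'v::finite \<Rightarrow>\<^sub>0 nat) = 0 \<longleftrightarrow> t = 0"
  by (auto simp: exp_deg_UNIV intro: poly_mapping_eqI)

definition hcomp :: "nat \<Rightarrow> ('v, 'k::comm_monoid_add) mpoly \<Rightarrow> ('v, 'k) mpoly" where
  "hcomp d p = (\<Sum>t\<in>{t \<in> Poly_Mapping.keys p. exp_deg t = d}. monom t (coeff_at p t))"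

lemma lookup_hcomp: "coeff_at (hcomp d p) t = (if exp_deg t = d then coeff_at p t else 0)"
  by (auto simp: hcomp_def lookup_sum lookup_single when_def in_keys_iff)

lemma hcomp_0 [simp]: "hcomp d 0 = 0" by (simp add: hcomp_def)

lemma hcomp_add: "hcomp d (p + q) = hcomp d p + hcomp d q"
  by (rule poly_mapping_eqI) (simp add: lookup_hcomp lookup_add)

lemma hcomp_diff: "hcomp d (p - q :: ('v, 'k::ab_group_add) mpoly) = hcomp d p - hcomp d q"
  by (rule poly_mapping_eqI) (simp add: lookup_hcomp lookup_minus)

lemma hcomp_sum: "hcomp d (sum h A) = (\<Sum>a\<in>A. hcomp d (h a))"
  by (induction A rule: infinite_finite_induct) (auto simp: hcomp_add)

lemma is_form_hcomp [simp]: "is_form d (hcomp d p)"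
  by (auto simp: is_form_iff in_keys_iff lookup_hcomp split: if_splits)

lemma hcomp_form: "is_form d p \<Longrightarrow> hcomp e p = (if e = d then p else 0)"
  by (intro poly_mapping_eqI) (auto simp: is_form_iff in_keys_iff lookup_hcomp)

lemma is_form_0 [simp]: "is_form d 0" by (simp add: is_form_iff)

lemma hcomp_eqI: "(\<And>d. hcomp d p = hcomp d q) \<Longrightarrow> p = q"
  by (metis lookup_hcomp poly_mapping_eqI)

lemma ex_hcomp_nonzero: "p \<noteq> 0 \<Longrightarrow> \<exists>d. hcomp d p \<noteq> 0"
  by (metis hcomp_0 hcomp_eqI)

lemma sum_hcomp: "p = (\<Sum>d\<in>exp_deg ` Poly_Mapping.keys p. hcomp d p)"
  by (rule poly_mapping_eqI) (auto simp: lookup_sum lookup_hcomp in_keys_iff)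

lemma is_form_add: "is_form d p \<Longrightarrow> is_form d q \<Longrightarrow> is_form d (p + q)"
  using keys_add[of p q] by (auto simp: is_form_iff)

lemma is_form_sum: "(\<And>a. a \<in> A \<Longrightarrow> is_form d (h a)) \<Longrightarrow> is_form d (sum h A)"
  by (induction A rule: infinite_finite_induct) (auto simp: is_form_add)

lemma is_form_mult:
  "is_form d p \<Longrightarrow> is_form e q \<Longrightarrow> is_form (d + e) (p * q :: ('v::finite, 'k::comm_ring_1) mpoly)"
  using keys_mult[of p q] by (fastforce simp: is_form_iff)

lemma is_form_diff:
  "is_form d p \<Longrightarrow> is_form d q \<Longrightarrow> is_form d (p - q :: ('v, 'k::ab_group_add) mpoly)"
  by (auto simp: is_form_iff in_keys_iff lookup_minus)

lemma is_form_const [simp]: "is_form 0 (const c :: ('v, 'k::zero) mpoly)"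
  by (auto simp: is_form_iff const_def exp_deg_def)

lemma is_form_0_eq_const:
  "is_form 0 (p :: ('v::finite, 'k::comm_ring_1) mpoly) \<Longrightarrow> p = const (coeff_at p 0)"
  by (intro poly_mapping_eqI) (auto simp: const_def is_form_iff in_keys_iff lookup_single when_def)

lemma is_form_const_mult: 
  "is_form d p \<Longrightarrow> is_form d (const c * p :: ('v::finite, 'k::comm_ring_1) mpoly)"
  using is_form_mult[of 0 "const c" d p] by simp

lemma is_form_partial_deriv:
  assumes "is_form (Suc d) (p :: ('v::finite, 'k::comm_ring_1) mpoly)"
  shows "is_form d (partial_deriv i p)"
  unfolding is_form_iff
proof
  fix t assume "t \<in> Poly_Mapping.keys (partial_deriv i p)"
  then have "t + monom i 1 \<in> Poly_Mapping.keys p"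
    by (auto simp: in_keys_iff lookup_partial_deriv)
  then have "exp_deg (t + monom i 1) = Suc d" using assms unfolding is_form_iff by blast
  then show "exp_deg t = d" by simp
qed

lemma hcomp_mult_form:
  fixes p q :: "('v::finite, 'k::comm_ring_1) mpoly"
  assumes "is_form e q"
  shows "hcomp n (p * q) = (if e \<le> n then hcomp (n - e) p * q else 0)"
proof (induction p rule: mpoly_monom_induct)
  case (monom t c)
  have f: "is_form (exp_deg t) (monom t c)" by (simp add: is_form_iff)
  show ?case
    using hcomp_form[OF is_form_mult[OF f assms], of n] hcomp_form[OF f, of "n - e"] by auto
qed (simp add: hcomp_add distrib_right)

text \<open>
  Both sides agree on monomials: \<open>x\<^sub>i \<partial>/\<partial>x\<^sub>i\<close> multiplies a monomial by its exponent at \<open>i\<close>.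
\<close>

lemma euler:
  fixes p :: "('v::finite, 'k::comm_ring_1) mpoly"
  assumes "is_form d p"
  shows "(\<Sum>i\<in>UNIV. var i * partial_deriv i p) = of_nat d * p"
proof -
  have m: "var i * monom (t - monom i 1) (of_nat (coeff_at t i) * c) = monom t (of_nat (coeff_at t i) * c)"
    for i :: 'v and t and c :: 'k
  proof (cases "coeff_at t i = 0")
    case False
    then have "monom i 1 + (t - monom i 1) = t"
      by (intro poly_mapping_eqI) (auto simp: lookup_add lookup_minus lookup_single when_def)
    then show ?thesis by (simp add: var_def mult_single)
  qed simp
  have "(\<Sum>i\<in>UNIV. var i * partial_deriv i p) =
    (\<Sum>t\<in>Poly_Mapping.keys p. \<Sum>i\<in>UNIV. monom t (of_nat (coeff_at t i) * coeff_at p t))"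
    unfolding partial_deriv_def sum_distrib_left m by (rule sum.swap)
  also have "\<dots> = (\<Sum>t\<in>Poly_Mapping.keys p. of_nat d * monom t (coeff_at p t))"
  proof (rule sum.cong)
    fix t assume "t \<in> Poly_Mapping.keys p"
    then have d: "d = (\<Sum>i\<in>UNIV. coeff_at t i)"
      using assms by (simp add: is_form_iff exp_deg_UNIV)
    have "(\<Sum>i\<in>UNIV. monom t (of_nat (coeff_at t i) * coeff_at p t)) = monom t (of_nat d * coeff_at p t)"
      by (rule poly_mapping_eqI)
        (auto simp: lookup_sum lookup_single when_def d sum_distrib_right)
    also have "\<dots> = of_nat d * monom t (coeff_at p t)"
      by (simp only: const_of_nat[symmetric] const_def mult_single add_0)
    finally show "(\<Sum>i\<in>UNIV. monom t (of_nat (coeff_at t i) * coeff_at p t)) = of_nat d * monom t (coeff_at p t)" .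
  qed simp
  also have "\<dots> = of_nat d * p"
    unfolding sum_distrib_left[symmetric] mpoly_eq_sum_monoms[of p, symmetric] ..
  finally show ?thesis .
qed

definition order_ge :: "nat \<Rightarrow> ('v, 'k::zero) mpoly \<Rightarrow> bool" where
  "order_ge D p \<longleftrightarrow> (\<forall>t\<in>Poly_Mapping.keys p. D \<le> exp_deg t)"

lemma order_ge_0 [simp]: "order_ge 0 p" "order_ge D 0"
  by (simp_all add: order_ge_def)

lemma order_ge_mult:
  assumes "order_ge D p" "order_ge E q"
  shows "order_ge (D + E) (p * q :: ('v::finite, 'k::comm_ring_1) mpoly)"
  unfolding order_ge_def
proof
  fix t assume "t \<in> Poly_Mapping.keys (p * q)"
  then obtain a b where "t = a + b" "a \<in> Poly_Mapping.keys p" "b \<in> Poly_Mapping.keys q"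
    using keys_mult[of p q] by auto
  then show "D + E \<le> exp_deg t"
    using assms by (auto simp: order_ge_def intro: add_mono)
qed

lemma order_ge_add: "order_ge D p \<Longrightarrow> order_ge D q \<Longrightarrow> order_ge D (p + q)"
  using keys_add[of p q] by (auto simp: order_ge_def)

lemma order_ge_sum: "(\<And>a. a \<in> A \<Longrightarrow> order_ge D (h a)) \<Longrightarrow> order_ge D (sum h A)"
  by (induction A rule: infinite_finite_induct) (auto intro: order_ge_add)

lemma order_ge_form: "is_form d p \<Longrightarrow> D \<le> d \<Longrightarrow> order_ge D p"
  by (simp add: order_ge_def is_form_iff)

lemma hcomp_order_ge: "order_ge D p \<Longrightarrow> d < D \<Longrightarrow> hcomp d p = 0"
  by (rule poly_mapping_eqI) (force simp: order_ge_def lookup_hcomp in_keys_iff)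

lemma order_geI:
  assumes "\<And>d. d < D \<Longrightarrow> hcomp d p = 0" shows "order_ge D p"
  unfolding order_ge_def
proof
  fix t assume "t \<in> Poly_Mapping.keys p"
  then have "coeff_at (hcomp (exp_deg t) p) t \<noteq> 0" by (simp add: lookup_hcomp in_keys_iff)
  then show "D \<le> exp_deg t" using assms[of "exp_deg t"] by fastforce
qed

lemma hcomp_zero: "hcomp 0 (p :: ('v::finite, 'k::comm_ring_1) mpoly) = const (coeff_at p 0)"
  using is_form_0_eq_const[of "hcomp 0 p"] by (simp add: lookup_hcomp exp_deg_def)

lemma is_form_one [simp]: "is_form 0 (1 :: ('v, 'k::zero_neq_one) mpoly)"
  by (metis is_form_const const_one)

lemma is_form_power:
  "is_form d p \<Longrightarrow> is_form (d * n) (p ^ n :: ('v::finite, 'k::comm_ring_1) mpoly)"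
proof (induction n)
  case 0
  then show ?case by simp
next
  case (Suc n)
  then show ?case using is_form_mult by fastforce
qed

lemma is_form_prod:
  fixes h :: "'a \<Rightarrow> ('v::finite, 'k::comm_ring_1) mpoly"
  shows "(\<And>a. a \<in> A \<Longrightarrow> is_form (D a) (h a)) \<Longrightarrow> is_form (sum D A) (prod h A)"
proof (induction A rule: infinite_finite_induct)
  case (insert x F)
  then show ?case using is_form_mult[of "D x" "h x"] by auto
qed simp_all

lemma is_form_poly_subst:
  fixes f :: "'m::finite \<Rightarrow> ('v::finite, 'k::comm_ring_1) mpoly"
  assumes F: "is_form d F" and f: "\<And>j. is_form e (f j)"
  shows "is_form (e * d) (poly_subst f F)"
  unfolding poly_subst_def
proof (rule is_form_sum, rule is_form_const_mult)
  fix t assume "t \<in> Poly_Mapping.keys F"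
  then have "d = (\<Sum>j\<in>UNIV. coeff_at t j)" using F by (simp add: is_form_iff exp_deg_UNIV)
  then have "e * d = (\<Sum>j\<in>UNIV. e * coeff_at t j)" by (simp add: sum_distrib_left)
  then show "is_form (e * d) (\<Prod>j\<in>UNIV. f j ^ coeff_at t j)"
    using is_form_prod[of UNIV "\<lambda>j. e * coeff_at t j" "\<lambda>j. f j ^ coeff_at t j"] is_form_power[OF f] by simp
qed

lemma of_nat_mult_eq_0_mpoly:
  "of_nat n * (p :: ('v::finite, 'k::field_char_0) mpoly) = 0 \<Longrightarrow> n \<noteq> 0 \<Longrightarrow> p = 0"
  unfolding const_of_nat[symmetric] by simp

lemma form_eq_0_if_partial_derivs_0:
  fixes p :: "('v::finite, 'k::field_char_0) mpoly"
  assumes "is_form (Suc d) p" "\<And>i. partial_deriv i p = 0"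
  shows "p = 0"
  using euler[OF assms(1)] assms(2) of_nat_mult_eq_0_mpoly[of "Suc d" p] by simp

text \<open>
  The products \<open>a i * p i\<close> start in degree \<open>d\<close>, with leading part \<open>a i\<close> times the constant
  coefficient of \<open>p i\<close>.
\<close>

lemma hcomp_dual_combination:
  fixes a p :: "nat \<Rightarrow> ('v::finite, 'k::comm_ring_1) mpoly"
  assumes "l < r" and p: "\<And>i. i < r \<Longrightarrow> hcomp 0 (p i) = (if i = l then 1 else 0)"
    and a: "\<And>i. i < r \<Longrightarrow> is_form d (a i)"
  shows "hcomp d (\<Sum>i<r. a i * p i) = a l"
proof -
  have "hcomp d (a i * p i) = (if i = l then a i else 0)" if "i < r" for i
    using hcomp_mult_form[OF a[OF that], of d "p i"] p[OF that] by (simp add: mult.commute)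
  then show ?thesis using \<open>l < r\<close> by (simp add: hcomp_sum)
qed

definition deg_le :: "nat \<Rightarrow> ('v, 'k::zero) mpoly \<Rightarrow> bool" where
  "deg_le D p \<longleftrightarrow> (\<forall>t\<in>Poly_Mapping.keys p. exp_deg t \<le> D)"

lemma deg_le_mult:
  assumes "deg_le D p" "deg_le E q"
  shows "deg_le (D + E) (p * q :: ('v::finite, 'k::comm_ring_1) mpoly)"
  unfolding deg_le_def
proof
  fix t assume "t \<in> Poly_Mapping.keys (p * q)"
  then obtain a b where "t = a + b" "a \<in> Poly_Mapping.keys p" "b \<in> Poly_Mapping.keys q"
    using keys_mult[of p q] by auto
  then show "exp_deg t \<le> D + E"
    using assms by (auto simp: deg_le_def intro: add_mono)
qed

lemma deg_le_one [simp]: "deg_le D (1 :: ('v::finite, 'k::comm_ring_1) mpoly)"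
  by (simp add: deg_le_def exp_deg_def)

lemma deg_le_power:
  "deg_le D p \<Longrightarrow> deg_le (D * n) (p ^ n :: ('v::finite, 'k::comm_ring_1) mpoly)"
  by (induction n) (auto dest: deg_le_mult)

lemma deg_le_prod:
  fixes h :: "'a \<Rightarrow> ('v::finite, 'k::comm_ring_1) mpoly"
  shows "(\<And>a. a \<in> A \<Longrightarrow> deg_le (D a) (h a)) \<Longrightarrow> deg_le (sum D A) (prod h A)"
  by (induction A rule: infinite_finite_induct) (auto intro: deg_le_mult)

section \<open>Quasi-regularity from derivations\<close>

text \<open>
  Generators \<open>F\<^sub>0, \<dots>, F\<^sub>r\<^sub>-\<^sub>1\<close> of an ideal \<open>P\<close>, with derivations that are dual to them up to a factor \<open>\<Delta>\<close>
  that is regular modulo \<open>P\<close>. For polynomials over a field this means that the zero set of \<open>P\<close> is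
  smooth of codimension \<open>r\<close> where \<open>\<Delta>\<close> does not vanish.
\<close>

locale dual_derivations =
  fixes F :: "nat \<Rightarrow> 'a::comm_ring_1" and r :: nat and \<delta> :: "nat \<Rightarrow> 'a \<Rightarrow> 'a" and \<Delta> :: 'a
  assumes \<delta>_add: "l < r \<Longrightarrow> \<delta> l (x + y) = \<delta> l x + \<delta> l y"
    and \<delta>_mult: "l < r \<Longrightarrow> \<delta> l (x * y) = \<delta> l x * y + x * \<delta> l y"
    and \<delta>_F: "l < r \<Longrightarrow> i < r \<Longrightarrow> \<delta> l (F i) = (if i = l then \<Delta> else 0)"
    and \<Delta>_regular: "\<Delta> * u \<in> ideal.span (F ` {..<r}) \<Longrightarrow> u \<in> ideal.span (F ` {..<r})"
    and of_nat_unit: "\<exists>v. of_nat (Suc n) * v = (1 :: 'a)"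
begin

abbreviation "J i \<equiv> ideal.span (F ` {..<i})"

text \<open>
  The ideal \<open>P\<^sup>n\<close>. One factor at a time is expanded in the generators, because the product rule is
  applied in this form.
\<close>

primrec Ppow :: "nat \<Rightarrow> 'a set" where
  "Ppow 0 = UNIV"
| "Ppow (Suc n) = {(\<Sum>l<r. F l * u l) | u. \<forall>l<r. u l \<in> Ppow n}"

definition "K i n = {a + b | a b. a \<in> J i \<and> b \<in> Ppow n}"

lemma subspace_Ppow: "ideal.subspace (Ppow n)"
proof (induction n)
  case (Suc n)
  note sub = Suc
  show ?case
  proof (rule ideal.subspaceI)
    have "\<forall>l<r. (\<lambda>_. 0) l \<in> Ppow n" using sub by (simp add: ideal.subspace_0)
    then show "0 \<in> Ppow (Suc n)" by (auto intro!: exI[of _ "\<lambda>_. 0"])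
  next
    fix x y assume "x \<in> Ppow (Suc n)" "y \<in> Ppow (Suc n)"
    then obtain u v where "x = (\<Sum>l<r. F l * u l)" "\<forall>l<r. u l \<in> Ppow n"
      "y = (\<Sum>l<r. F l * v l)" "\<forall>l<r. v l \<in> Ppow n" by auto
    then have "x + y = (\<Sum>l<r. F l * (u l + v l))" "\<forall>l<r. u l + v l \<in> Ppow n"
      using sub by (auto simp: sum.distrib distrib_left ideal.subspace_add)
    then show "x + y \<in> Ppow (Suc n)" by (auto intro!: exI[of _ "\<lambda>l. u l + v l"])
  next
    fix c x assume "x \<in> Ppow (Suc n)"
    then obtain u where "x = (\<Sum>l<r. F l * u l)" "\<forall>l<r. u l \<in> Ppow n" by auto
    moreover from this have "c * x = (\<Sum>l<r. F l * (c * u l))"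
      by (simp add: sum_distrib_left ac_simps)
    moreover from calculation have "\<forall>l<r. c * u l \<in> Ppow n"
      using ideal.subspace_scale[OF sub] by blast
    ultimately show "c * x \<in> Ppow (Suc n)" by (auto intro!: exI[of _ "\<lambda>l. c * u l"])
  qed
qed simp

lemma F_mult_Ppow: "u \<in> Ppow n \<Longrightarrow> l < r \<Longrightarrow> F l * u \<in> Ppow (Suc n)"
  using subspace_Ppow[of n]
  by (auto intro!: exI[of _ "\<lambda>j. if j = l then u else 0"] simp: if_distrib ideal.subspace_0 cong: if_cong)

lemma Ppow_Suc_subset: "Ppow (Suc n) \<subseteq> Ppow n"
proof (induction n)
  case (Suc n)
  show ?case
  proof
    fix x assume "x \<in> Ppow (Suc (Suc n))"
    then obtain u where u: "x = (\<Sum>l<r. F l * u l)" "\<forall>l<r. u l \<in> Ppow (Suc n)" by auto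
    then have "\<forall>l<r. u l \<in> Ppow n" using Suc by blast
    with u show "x \<in> Ppow (Suc n)" by auto
  qed
qed simp

lemma subspace_K: "ideal.subspace (K i n)"
proof (rule ideal.subspaceI)
  show "0 \<in> K i n"
    using ideal.span_zero ideal.subspace_0[OF subspace_Ppow] unfolding K_def by force
next
  fix x y assume "x \<in> K i n" "y \<in> K i n"
  then obtain a b c d where *: "x = a + b" "y = c + d" "a \<in> J i" "c \<in> J i" "b \<in> Ppow n" "d \<in> Ppow n"
    unfolding K_def by auto
  have "x + y = (a + c) + (b + d)" using * by simp
  then show "x + y \<in> K i n"
    using * ideal.span_add ideal.subspace_add[OF subspace_Ppow] unfolding K_def by blast
next
  fix c x assume "x \<in> K i n"
  then obtain a b where *: "x = a + b" "a \<in> J i" "b \<in> Ppow n"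
    unfolding K_def by auto
  have "c * x = c * a + c * b" using * by (simp add: distrib_left)
  then show "c * x \<in> K i n"
    using * ideal.span_scale ideal.subspace_scale[OF subspace_Ppow] unfolding K_def by blast
qed

lemmas K_add = ideal.subspace_add[OF subspace_K] and K_diff = ideal.subspace_diff[OF subspace_K]
  and K_scale = ideal.subspace_scale[OF subspace_K] and K_sum = ideal.subspace_sum[OF subspace_K]

lemma J_subset_K: "x \<in> J i \<Longrightarrow> x \<in> K i n"
  using ideal.subspace_0[OF subspace_Ppow, of n] unfolding K_def by force

lemma Ppow_subset_K: "x \<in> Ppow n \<Longrightarrow> x \<in> K i n"
  using ideal.span_zero unfolding K_def by force

lemma K_0 [simp]: "x \<in> K i 0"
  by (rule Ppow_subset_K) simp

lemma K_Suc_subset: "x \<in> K i (Suc n) \<Longrightarrow> x \<in> K i n"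
  using Ppow_Suc_subset[of n] unfolding K_def by blast

lemma J_mono: "i \<le> j \<Longrightarrow> J i \<subseteq> J j"
  by (rule ideal.span_mono) auto

lemma K_mono: "i \<le> j \<Longrightarrow> x \<in> K i n \<Longrightarrow> x \<in> K j n"
  using J_mono[of i j] unfolding K_def by blast

lemma F_mult_K: 
  assumes "x \<in> K i n" "l < r" shows "F l * x \<in> K i (Suc n)"
proof -
  obtain a b where *: "x = a + b" "a \<in> J i" "b \<in> Ppow n"
    using assms unfolding K_def by auto
  have "F l * x = F l * a + F l * b" using * by (simp add: distrib_left)
  then show ?thesis
    using ideal.span_scale[OF *(2)] F_mult_Ppow[OF *(3) assms(2)] unfolding K_def by blast
qed

lemma K_r_Suc: "x \<in> K r (Suc n) \<longleftrightarrow> x \<in> J r"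
proof
  assume "x \<in> K r (Suc n)"
  then obtain a u where "x = a + (\<Sum>l<r. F l * u l)" "a \<in> J r" unfolding K_def by auto
  moreover have "(\<Sum>l<r. F l * u l) \<in> J r"
    unfolding mult.commute[of "F _"] by (intro ideal.span_sum ideal.span_scale ideal.span_base) auto
  ultimately show "x \<in> J r" by (simp add: ideal.span_add)
qed (rule J_subset_K)

lemma \<delta>_0 [simp]: "l < r \<Longrightarrow> \<delta> l 0 = 0"
  using \<delta>_add[of l 0 0] by simp

lemma \<delta>_sum: "l < r \<Longrightarrow> \<delta> l (sum h A) = (\<Sum>a\<in>A. \<delta> l (h a))"
  by (induction A rule: infinite_finite_induct) (auto simp: \<delta>_add)

lemma \<delta>_J:
  assumes "x \<in> J i" "i \<le> l" "l < r"
  shows "\<delta> l x \<in> J i"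
  using assms(1)
proof (induction rule: ideal.span_induct_alt)
  case base
  then show ?case using assms(3) by (simp add: ideal.span_zero)
next
  case (step c x y)
  then have "\<delta> l x = 0" using assms by (auto simp: \<delta>_F)
  moreover have "x * \<delta> l c \<in> J i" 
    by (metis ideal.span_base ideal.span_scale mult.commute step(1))
  ultimately show ?case 
    using step assms(3) by (simp add: \<delta>_add \<delta>_mult ideal.span_add mult.commute)
qed

lemma \<delta>_Ppow: "x \<in> Ppow (Suc n) \<Longrightarrow> l < r \<Longrightarrow> \<delta> l x \<in> Ppow n"
proof (induction n arbitrary: x)
  case (Suc n)
  then obtain u where u: "x = (\<Sum>j<r. F j * u j)" "\<And>j. j < r \<Longrightarrow> u j \<in> Ppow (Suc n)" by auto
  have "\<delta> l (F j) * u j + F j * \<delta> l (u j) \<in> Ppow (Suc n)" if "j < r" for j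
    using ideal.subspace_scale[OF subspace_Ppow u(2)[OF that]]
      F_mult_Ppow[OF Suc.IH[OF u(2)[OF that] Suc.prems(2)] that]
    by (rule ideal.subspace_add[OF subspace_Ppow])
  then show ?case
    unfolding u(1) \<delta>_sum[OF Suc.prems(2)] \<delta>_mult[OF Suc.prems(2)]
    by (intro ideal.subspace_sum[OF subspace_Ppow]) auto
qed simp

lemma \<delta>_K:
  assumes "x \<in> K i (Suc n)" "i \<le> l" "l < r" shows "\<delta> l x \<in> K i n"
proof -
  obtain a b where *: "x = a + b" "a \<in> J i" "b \<in> Ppow (Suc n)"
    using assms unfolding K_def by auto
  show ?thesis
    using \<delta>_J[OF *(2) assms(2,3)] \<delta>_Ppow[OF *(3) assms(3)] 
    unfolding K_def *(1) \<delta>_add[OF assms(3)] by blast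
qed

text \<open>
  The Euler operator of the generators \<open>F\<^sub>i, \<dots>, F\<^sub>r\<^sub>-\<^sub>1\<close>.
\<close>

definition "E i u = (\<Sum>l\<in>{i..<r}. F l * \<delta> l u)"

lemma E_sum: "E i (sum h A) = (\<Sum>a\<in>A. E i (h a))"
  unfolding E_def by (subst sum.swap) (auto simp: \<delta>_sum sum_distrib_left intro!: sum.cong)

lemma E_mult: "E i (x * y) = E i x * y + x * E i y"
  unfolding E_def
  by (auto simp: sum_distrib_left sum_distrib_right algebra_simps \<delta>_mult simp flip: sum.distrib intro!: sum.cong)

lemma E_F: "j < r \<Longrightarrow> E i (F j) = (if i \<le> j then \<Delta> * F j else 0)"
  by (simp add: E_def \<delta>_F if_distrib mult.commute cong: if_cong)

text \<open>
  On \<open>P\<^sup>n\<close> the Euler operator acts as multiplication by \<open>n \<Delta>\<close>, up to higher powers of \<open>P\<close> and up to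
  the generators that it does not see: each factor \<open>F\<^sub>l\<close> contributes \<open>\<Delta>\<close> by the product rule.
\<close>

lemma E_Ppow: "u \<in> Ppow n \<Longrightarrow> E i u - of_nat n * \<Delta> * u \<in> K i (Suc n)"
proof (induction n arbitrary: u)
  case 0
  have "(\<Sum>l\<in>{i..<r}. F l * \<delta> l u) \<in> Ppow (Suc 0)"
    by (intro ideal.subspace_sum[OF subspace_Ppow] F_mult_Ppow) auto
  then show ?case by (simp add: E_def Ppow_subset_K del: Ppow.simps)
next
  case (Suc n)
  then obtain v where v: "u = (\<Sum>j<r. F j * v j)" "\<And>j. j < r \<Longrightarrow> v j \<in> Ppow n" by auto
  have *: "E i (F j * v j) - of_nat (Suc n) * \<Delta> * (F j * v j) \<in> K i (Suc (Suc n))" if j: "j < r" for j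
  proof (cases "i \<le> j")
    case True
    have "E i (F j * v j) - of_nat (Suc n) * \<Delta> * (F j * v j) = F j * (E i (v j) - of_nat n * \<Delta> * v j)"
      using True j by (simp add: E_mult E_F algebra_simps)
    then show ?thesis using F_mult_K[OF Suc.IH[OF v(2)[OF j]] j] by simp
  next
    case False
    have "F j \<in> J i" using False by (intro ideal.span_base) auto
    from ideal.span_scale[OF this, of "E i (v j) - of_nat (Suc n) * \<Delta> * v j"]
    have "E i (F j * v j) - of_nat (Suc n) * \<Delta> * (F j * v j) \<in> J i"
      using False j by (simp add: E_mult E_F algebra_simps)
    then show ?thesis by (rule J_subset_K)
  qed
  have "E i u - of_nat (Suc n) * \<Delta> * u = (\<Sum>j<r. E i (F j * v j) - of_nat (Suc n) * \<Delta> * (F j * v j))"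
    unfolding v(1) E_sum by (simp add: sum_subtractf sum_distrib_left)
  then show ?case using * by (auto intro!: K_sum)
qed

lemma of_nat_cancel_K: "of_nat (Suc n) * x \<in> K i m \<Longrightarrow> x \<in> K i m"
  by (metis K_scale mult.assoc mult.commute mult_1 of_nat_unit)

text \<open>
  In the associated graded ring modulo \<open>J\<^sub>i\<close>, the elements \<open>\<Delta>\<close> and \<open>F\<^sub>i\<close> are regular. Both claims are
  proved by simultaneous induction on \<open>n\<close>.

  For \<open>\<Delta>\<close> one descends from \<open>i = r\<close>, where \<open>\<Delta>\<close> is regular by assumption. The claim for \<open>i + 1\<close> gives
  \<open>w \<equiv> F\<^sub>i h\<close> modulo \<open>J\<^sub>i + P\<^sup>n\<close>; then \<open>F\<^sub>i\<close> and \<open>\<Delta>\<close> are cancelled one power lower, which shows that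
  \<open>h \<in> J\<^sub>i + P\<^sup>n\<^sup>-\<^sup>1\<close>.

  For \<open>F\<^sub>i\<close> let \<open>F\<^sub>i w \<in> J\<^sub>i + P\<^sup>n\<^sup>+\<^sup>2\<close>; by induction one may take \<open>w \<in> P\<^sup>n\<close>. Modulo \<open>J\<^sub>i + P\<^sup>n\<^sup>+\<^sup>1\<close>, the derivation \<open>\<delta>\<^sub>i\<close>
  gives \<open>\<Delta> w + F\<^sub>i \<delta>\<^sub>i w \<equiv> 0\<close>, and for \<open>l > i\<close> the derivation \<open>\<delta>\<^sub>l\<close> and the induction hypothesis give
  \<open>F\<^sub>l \<delta>\<^sub>l w \<equiv> 0\<close>. The Euler operator therefore yields \<open>n \<Delta> w \<equiv> F\<^sub>i \<delta>\<^sub>i w\<close>, so that \<open>(n + 1) \<Delta> w \<equiv> 0\<close>, where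
  both factors can be cancelled.
\<close>

proposition quasi_regular:
  shows "i \<le> r \<Longrightarrow> \<Delta> * w \<in> K i n \<Longrightarrow> w \<in> K i n"
    and "i < r \<Longrightarrow> F i * w \<in> K i (Suc n) \<Longrightarrow> w \<in> K i n"
proof (induction n arbitrary: i w)
  case 0
  { case 1 then show ?case by simp next case 2 then show ?case by simp }
next
  case (Suc n)
  have D: "w \<in> K i (Suc n)" if "i \<le> r" "\<Delta> * w \<in> K i (Suc n)" for i w
    using that
  proof (induction arbitrary: w rule: inc_induct)
    case base
    then show ?case using \<Delta>_regular by (simp add: K_r_Suc)
  next
    case (step i)
    have "w \<in> K (Suc i) (Suc n)"
      using step.IH K_mono[OF _ step.prems, of "Suc i"] by simp
    then obtain a b where ab: "w = a + b" "a \<in> J (Suc i)" "b \<in> Ppow (Suc n)"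
      unfolding K_def by blast
    obtain h where "a - h * F i \<in> J i"
      using ab(2) unfolding lessThan_Suc image_insert ideal.span_breakdown_eq by blast
    then have rest: "w - F i * h \<in> K i (Suc n)"
      using K_add[OF J_subset_K Ppow_subset_K[OF ab(3)], of "a - h * F i" i]
      by (simp add: ab(1) algebra_simps)
    have "F i * (\<Delta> * h) = \<Delta> * w - \<Delta> * (w - F i * h)" by (simp add: algebra_simps)
    also have "\<dots> \<in> K i (Suc n)" by (intro K_diff step.prems K_scale rest)
    finally have "\<Delta> * h \<in> K i n" using Suc.IH(2) step.hyps by simp
    then have "h \<in> K i n" using Suc.IH(1) step.hyps by simp
    then have "F i * h \<in> K i (Suc n)" using F_mult_K step.hyps by simp
    from K_add[OF this rest] show ?case by simp
  qed
  { case 1 then show ?case using D by blast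
  next
    case 2
    note i = 2(1)
    have "w \<in> K i n" using Suc.IH(2) i 2(2) K_Suc_subset by blast
    then obtain a b where ab: "w = a + b" "a \<in> J i" "b \<in> Ppow n"
      unfolding K_def by blast
    have "F i * b = F i * w - F i * a" by (simp add: ab(1) algebra_simps)
    also have "\<dots> \<in> K i (Suc (Suc n))"
      by (intro K_diff 2 K_scale J_subset_K ab)
    finally have Fb: "F i * b \<in> K i (Suc (Suc n))" .
    have other: "F l * \<delta> l b \<in> K i (Suc n)" if l: "i < l" "l < r" for l
    proof -
      have "\<delta> l (F i * b) \<in> K i (Suc n)" using \<delta>_K[OF Fb] l by simp
      then have "F i * \<delta> l b \<in> K i (Suc n)" using l i by (simp add: \<delta>_mult \<delta>_F)
      then have "\<delta> l b \<in> K i n" using Suc.IH(2) i by blast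
      then show ?thesis using F_mult_K l by blast
    qed
    have own: "\<Delta> * b + F i * \<delta> i b \<in> K i (Suc n)"
      using \<delta>_K[OF Fb, of i] i by (simp add: \<delta>_mult \<delta>_F)
    have Eb: "E i b = F i * \<delta> i b + (\<Sum>l\<in>{Suc i..<r}. F l * \<delta> l b)"
      unfolding E_def using i by (simp add: sum.atLeast_Suc_lessThan)
    have "(\<Sum>l\<in>{Suc i..<r}. F l * \<delta> l b) \<in> K i (Suc n)"
      by (intro K_sum) (auto intro: other)
    from K_add[OF K_diff[OF own E_Ppow[OF ab(3), of i]] this]
    have "of_nat (Suc n) * (\<Delta> * b) \<in> K i (Suc n)"
      unfolding Eb by (simp add: algebra_simps)
    then have "b \<in> K i (Suc n)" using of_nat_cancel_K D i by (meson less_imp_le)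
    then show ?case using ab K_add J_subset_K by blast
  }
qed

corollary F_cancel: "i < r \<Longrightarrow> F i * h \<in> J i \<Longrightarrow> h \<in> K i n"
  using quasi_regular(2) J_subset_K by blast

end

section \<open>Modules of homological dimension at most one\<close>

lemma hom_onD:
  assumes "hom_on s s' M N h"
  shows "x \<in> M \<Longrightarrow> h x \<in> N" "x \<in> M \<Longrightarrow> y \<in> M \<Longrightarrow> h (x + y) = h x + h y"
    "x \<in> M \<Longrightarrow> h (s c x) = s' c (h x)"
  using assms by (auto simp: hom_on_def)

lemma hom_on_0: "hom_on s s' M N h \<Longrightarrow> 0 \<in> M \<Longrightarrow> h 0 = 0"
  using hom_onD(2)[of s s' M N h 0 0] by simp

lemma hom_on_sum:
  assumes h: "hom_on s s' M N h" and M: "module s" "module.subspace s M"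
    and x: "\<And>a. a \<in> A \<Longrightarrow> x a \<in> M"
  shows "h (sum x A) = (\<Sum>a\<in>A. h (x a))"
  using x
proof (induction A rule: infinite_finite_induct)
  case (insert a F)
  interpret module s by fact
  show ?case
    using insert M(2) by (simp add: hom_onD(2)[OF h] subspace_sum)
qed (use hom_on_0[OF h] module.subspace_0[OF M] in auto)

lemma hom_on_diff:
  assumes h: "hom_on s s' M N h" and M: "module s" "module.subspace s M" and "x \<in> M" "y \<in> M"
  shows "h (x - y) = h x - h y"
  using hom_onD(2)[OF h module.subspace_diff[OF M assms(4,5)] assms(5)] by simp

lemma hom_on_compose:
  "hom_on s s' M N h \<Longrightarrow> hom_on s' s'' N L g \<Longrightarrow> hom_on s s'' M L (\<lambda>x. g (h x))"
  by (auto simp: hom_on_def image_subset_iff)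

lemma hom_on_combination:
  fixes M :: "('r::comm_ring_1 ^ 'm) set"
  assumes \<phi>: "hom_on (*s) (*) M UNIV \<phi>" and M: "rvec.subspace M" and v: "\<And>i. i < r \<Longrightarrow> v i \<in> M"
  shows "\<phi> (\<Sum>i<r. a i *s v i) = (\<Sum>i<r. a i * \<phi> (v i))"
proof -
  have "\<phi> (\<Sum>i<r. a i *s v i) = (\<Sum>i<r. \<phi> (a i *s v i))"
    by (rule hom_on_sum[OF \<phi> module_vec M]) (use v M in \<open>auto intro: rvec.subspace_scale\<close>)
  then show ?thesis using v by (simp add: hom_onD(3)[OF \<phi>])
qed

lemma free_expansion: "y = (\<Sum>b\<in>Poly_Mapping.keys y. free_scale (coeff_at y b) (Poly_Mapping.single b 1))"
  by (rule poly_mapping_eqI) (auto simp: lookup_sum lookup_single when_def in_keys_iff if_distrib cong: if_cong)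

lemma hom_on_free_expansion:
  assumes h: "hom_on free_scale s UNIV N h"
  shows "h y = (\<Sum>b\<in>Poly_Mapping.keys y. s (coeff_at y b) (h (Poly_Mapping.single b 1)))"
proof -
  have "h y = h (\<Sum>b\<in>Poly_Mapping.keys y. free_scale (coeff_at y b) (Poly_Mapping.single b 1))"
    using free_expansion[of y] by (rule arg_cong)
  also have "\<dots> = (\<Sum>b\<in>Poly_Mapping.keys y. h (free_scale (coeff_at y b) (Poly_Mapping.single b 1)))"
    by (rule hom_on_sum[OF h module_free_scale]) auto
  also have "\<dots> = (\<Sum>b\<in>Poly_Mapping.keys y. s (coeff_at y b) (h (Poly_Mapping.single b 1)))"
    by (simp add: hom_onD(3)[OF h])
  finally show ?thesis .
qed

lemma ex_free_extension:
  fixes w :: "'i \<Rightarrow> 'r::comm_ring_1 ^ 'm"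
  shows "\<exists>h. hom_on free_scale (*s) UNIV UNIV h \<and> (\<forall>b. h (Poly_Mapping.single b 1) = w b)"
proof -
  define h where "h y = (\<Sum>b\<in>Poly_Mapping.keys y. coeff_at y b *s w b)" for y
  have sup: "h y = (\<Sum>b\<in>A. coeff_at y b *s w b)" if "finite A" "Poly_Mapping.keys y \<subseteq> A" for y A
    unfolding h_def using that by (intro sum.mono_neutral_left) (auto simp: in_keys_iff)
  have "h (x + y) = h x + h y" for x y
    using keys_add[of x y]
    by (simp add: sup[of "Poly_Mapping.keys x \<union> Poly_Mapping.keys y"] lookup_add sum.distrib rvec.scale_left_distrib)
  moreover have "h (free_scale c x) = c *s h x" for c x
  proof -
    have "Poly_Mapping.keys (free_scale c x) \<subseteq> Poly_Mapping.keys x"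
      by (auto simp: in_keys_iff)
    then show ?thesis
      by (simp add: sup[of "Poly_Mapping.keys x"] rvec.scale_sum_right)
  qed
  moreover have "h (Poly_Mapping.single b 1) = w b" for b
    by (simp add: h_def)
  ultimately show ?thesis unfolding hom_on_def by blast
qed

text \<open>
  Lengths 0 and 1 are treated alike: in both cases the second module of the resolution is zero,
  so that the first differential is injective.
\<close>

lemma homological_dimension_le_1D:
  fixes M :: "('r::comm_ring_1 ^ 'n) set"
  assumes "homological_dimension (*s) M \<le> 1"
  obtains P0 P1 :: "((nat \<times> 'r \<times> ('r ^ 'n)) \<Rightarrow>\<^sub>0 'r) set" and \<delta> \<epsilon> where
    "projective free_scale P0" "projective free_scale P1"
    "hom_on free_scale (*s) P0 M \<epsilon>" "hom_on free_scale free_scale P1 P0 \<delta>"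
    "\<epsilon> ` P0 = M" "{x \<in> P0. \<epsilon> x = 0} = \<delta> ` P1" "inj_on \<delta> P1"
proof -
  let ?S = "{enat d | d. \<exists>(P :: nat \<Rightarrow> ((nat \<times> 'r \<times> ('r ^ 'n)) \<Rightarrow>\<^sub>0 'r) set) \<delta> \<epsilon>.
       projective_resolution free_scale (*s) d P \<delta> \<epsilon> M}"
  have le: "Inf ?S \<le> 1" using assms unfolding homological_dimension_def .
  have "Inf A \<in> A" if "Inf A \<le> 1" for A :: "enat set"
  proof -
    have "A \<noteq> {}" using that by (auto simp: Inf_enat_def one_enat_def)
    then obtain a where "a \<in> A" by blast
    then show ?thesis by (rule wellorder_InfI)
  qed
  from this[OF le]
  obtain d and P :: "nat \<Rightarrow> ((nat \<times> 'r \<times> ('r ^ 'n)) \<Rightarrow>\<^sub>0 'r) set" and \<delta> \<epsilon>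
    where d: "Inf ?S = enat d" and "projective_resolution free_scale (*s) d P \<delta> \<epsilon> M" by blast
  then have proj: "\<And>i. projective free_scale (P i)" and zero: "\<And>i. i > d \<Longrightarrow> P i = {0}"
    and \<epsilon>: "hom_on free_scale (*s) (P 0) M \<epsilon>" "\<epsilon> ` P 0 = M"
    and \<delta>: "\<And>i. hom_on free_scale free_scale (P (Suc i)) (P i) (\<delta> i)"
    and ex0: "{x \<in> P 0. \<epsilon> x = 0} = \<delta> 0 ` P 1"
    and ex: "\<And>i. {x \<in> P (Suc i). \<delta> i x = 0} = \<delta> (Suc i) ` P (Suc (Suc i))"
    unfolding projective_resolution_def by blast+
  have "d \<le> 1" using d le by (simp add: one_enat_def)
  then have "P (Suc (Suc 0)) = {0}" by (intro zero) simp
  moreover have "\<delta> (Suc 0) 0 = 0"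
    using hom_on_0[OF \<delta>[of "Suc 0"]] \<open>P (Suc (Suc 0)) = {0}\<close> by simp
  ultimately have ker: "{x \<in> P 1. \<delta> 0 x = 0} = {0}" using ex[of 0] by simp
  have sub: "free.subspace (P 1)" using proj[of 1] by (simp add: projective_def)
  have "inj_on (\<delta> 0) (P 1)"
  proof (rule inj_onI)
    fix x y assume "x \<in> P 1" "y \<in> P 1" "\<delta> 0 x = \<delta> 0 y"
    then have "x - y \<in> {x \<in> P 1. \<delta> 0 x = 0}"
      using hom_on_diff[OF \<delta>[of 0] module_free_scale, of x y] sub by (simp add: free.subspace_diff)
    then show "x = y" unfolding ker by simp
  qed
  then show thesis using that[OF proj proj \<epsilon>(1) _ \<epsilon>(2) ex0] \<delta>[of 0] by simp
qed

text \<open>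
  The module \<open>Z\<close> of syzygies is projective, in the form of a dual basis: \<open>z\<close> is a combination of
  elements of \<open>Z\<close> whose coefficients are values of functionals at \<open>z\<close>. The proof is that of
  Schanuel's lemma. Let \<open>\<alpha>\<close> and \<open>\<beta>\<close> be lifts of the identity between the free presentation with
  kernel \<open>Z\<close> and the projective resolution with kernel \<open>P1\<close>. Then \<open>z = (z - \<beta> (\<alpha> z)) + \<beta> (\<alpha> z)\<close>. The
  first summand is the value at \<open>z\<close> of a map from a free module to \<open>Z\<close>, and the second factors
  through the projective module \<open>P1\<close> because \<open>\<alpha>\<close> maps \<open>Z\<close> into the kernel of \<open>\<epsilon>\<close>.
\<close>

theorem syzygy_in_trace_span:
  fixes d :: "'m::finite \<Rightarrow> 'r::comm_ring_1 ^ 'n"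
  assumes hd: "homological_dimension (*s) (rvec.span (range d)) \<le> 1"
    and Z: "Z = {v :: 'r ^ 'm. (\<Sum>j\<in>UNIV. (v $ j) *s d j) = 0}" and z: "z \<in> Z"
  shows "z \<in> rvec.span {\<phi> z *s w | \<phi> w. hom_on (*s) (*) Z UNIV \<phi> \<and> w \<in> Z}"
proof -
  obtain P0 P1 :: "((nat \<times> 'r \<times> ('r ^ 'n)) \<Rightarrow>\<^sub>0 'r) set" and \<delta> \<epsilon> where
    P0: "projective free_scale P0" and P1: "projective free_scale P1" and
    \<epsilon>: "hom_on free_scale (*s) P0 (rvec.span (range d)) \<epsilon>" "\<epsilon> ` P0 = rvec.span (range d)" and
    \<delta>: "hom_on free_scale free_scale P1 P0 \<delta>" and
    ker: "{x \<in> P0. \<epsilon> x = 0} = \<delta> ` P1" and inj: "inj_on \<delta> P1"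
    by (rule homological_dimension_le_1D[OF hd])
  have sub0: "free.subspace P0" and sub1: "free.subspace P1"
    using P0 P1 by (auto simp: projective_def)
  obtain \<iota>0 :: "_ \<Rightarrow> ((nat \<times> 'r \<times> ('r ^ 'n)) \<Rightarrow>\<^sub>0 'r) \<Rightarrow>\<^sub>0 'r" and \<pi>0 where
    \<iota>0: "hom_on free_scale free_scale P0 UNIV \<iota>0" and \<pi>0: "hom_on free_scale free_scale UNIV P0 \<pi>0"
    and id0: "\<And>x. x \<in> P0 \<Longrightarrow> \<pi>0 (\<iota>0 x) = x"
    using P0 unfolding projective_def by blast
  obtain \<iota>1 :: "_ \<Rightarrow> ((nat \<times> 'r \<times> ('r ^ 'n)) \<Rightarrow>\<^sub>0 'r) \<Rightarrow>\<^sub>0 'r" and \<pi>1 where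
    \<iota>1: "hom_on free_scale free_scale P1 UNIV \<iota>1" and \<pi>1: "hom_on free_scale free_scale UNIV P1 \<pi>1"
    and id1: "\<And>x. x \<in> P1 \<Longrightarrow> \<pi>1 (\<iota>1 x) = x"
    using P1 unfolding projective_def by blast
  define g where "g v = (\<Sum>j\<in>UNIV. (v $ j) *s d j)" for v :: "'r ^ 'm"
  have g_hom: "hom_on (*s) (*s) UNIV UNIV g"
    by (auto simp: hom_on_def g_def rvec.scale_left_distrib sum.distrib rvec.scale_sum_right)
  have Zg: "v \<in> Z \<longleftrightarrow> g v = 0" for v by (simp add: Z g_def)
  have g_axis: "g (axis j 1) = d j" for j
  proof -
    have "g (axis j 1) = (\<Sum>i\<in>UNIV. if i = j then d j else 0)"
      unfolding g_def by (intro sum.cong) (auto simp: axis_def)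
    then show ?thesis by simp
  qed
  \<comment> \<open>\<open>\<alpha>\<close> and \<open>\<beta>\<close> lift the identity of the module along the two presentations\<close>
  have "\<exists>p. p \<in> P0 \<and> \<epsilon> p = d j" for j
    using \<epsilon>(2) rvec.span_base[of "d j" "range d"] by (metis imageE rangeI)
  then obtain p where p: "\<And>j. p j \<in> P0" "\<And>j. \<epsilon> (p j) = d j" by metis
  define \<alpha> where "\<alpha> v = (\<Sum>j\<in>UNIV. free_scale (v $ j) (p j))" for v :: "'r ^ 'm"
  have \<alpha>_P0: "\<alpha> v \<in> P0" for v
    unfolding \<alpha>_def by (intro free.subspace_sum sub0 free.subspace_scale p)
  have \<alpha>_hom: "hom_on (*s) free_scale UNIV P0 \<alpha>"
    using \<alpha>_P0 by (auto simp: hom_on_def \<alpha>_def free.scale_left_distrib sum.distrib free.scale_sum_right)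
  have \<epsilon>\<alpha>: "\<epsilon> (\<alpha> v) = g v" for v
  proof -
    have "\<epsilon> (\<alpha> v) = (\<Sum>j\<in>UNIV. \<epsilon> (free_scale (v $ j) (p j)))"
      unfolding \<alpha>_def by (rule hom_on_sum[OF \<epsilon>(1) module_free_scale sub0])
        (intro free.subspace_scale sub0 p)
    then show ?thesis by (simp add: g_def hom_onD(3)[OF \<epsilon>(1)] p)
  qed
  have "\<exists>v. g v = \<epsilon> (\<pi>0 (Poly_Mapping.single b 1))" for b
  proof -
    have "\<epsilon> (\<pi>0 (Poly_Mapping.single b 1)) \<in> rvec.span (range d)"
      by (rule hom_onD(1)[OF \<epsilon>(1) hom_onD(1)[OF \<pi>0]]) simp
    then obtain a where "\<epsilon> (\<pi>0 (Poly_Mapping.single b 1)) = (\<Sum>j\<in>UNIV. a j *s d j)"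
      using rvec.span_image_coordinates[of UNIV _ d] by auto
    then have "g (\<chi> j. a j) = \<epsilon> (\<pi>0 (Poly_Mapping.single b 1))" by (simp add: g_def)
    then show ?thesis by blast
  qed
  then obtain w where w: "\<And>b. g (w b) = \<epsilon> (\<pi>0 (Poly_Mapping.single b 1))" by metis
  obtain L where L: "hom_on free_scale (*s) UNIV UNIV L" "\<And>b. L (Poly_Mapping.single b 1) = w b"
    using ex_free_extension[of w] by blast
  define \<beta> where "\<beta> x = L (\<iota>0 x)" for x
  have \<beta>_hom: "hom_on free_scale (*s) P0 UNIV \<beta>"
    unfolding \<beta>_def by (rule hom_on_compose[OF \<iota>0 L(1)])
  have gL: "hom_on free_scale (*s) UNIV UNIV (\<lambda>y. g (L y))"
    by (rule hom_on_compose[OF L(1) g_hom])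
  have \<epsilon>\<pi>: "hom_on free_scale (*s) UNIV (rvec.span (range d)) (\<lambda>y. \<epsilon> (\<pi>0 y))"
    by (rule hom_on_compose[OF \<pi>0 \<epsilon>(1)])
  have "g (L y) = \<epsilon> (\<pi>0 y)" for y
    unfolding hom_on_free_expansion[OF gL, of y] hom_on_free_expansion[OF \<epsilon>\<pi>, of y] by (simp add: L w)
  then have g\<beta>: "g (\<beta> x) = \<epsilon> x" if "x \<in> P0" for x
    using that by (simp add: \<beta>_def id0)
  \<comment> \<open>\<open>\<alpha>\<close> maps \<open>Z\<close> into the image of the injective map \<open>\<delta>\<close>, so it lifts to \<open>P1\<close>\<close>
  define \<gamma> where "\<gamma> v = the_inv_into P1 \<delta> (\<alpha> v)" for v
  have \<gamma>: "\<gamma> v \<in> P1" "\<delta> (\<gamma> v) = \<alpha> v" if "v \<in> Z" for v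
  proof -
    have "\<alpha> v \<in> \<delta> ` P1" using that ker \<alpha>_P0[of v] \<epsilon>\<alpha>[of v] by (auto simp: Zg)
    then show "\<gamma> v \<in> P1" "\<delta> (\<gamma> v) = \<alpha> v"
      unfolding \<gamma>_def using inj by (auto intro: the_inv_into_into f_the_inv_into_f)
  qed
  have subZ: "rvec.subspace Z"
    by (rule rvec.subspaceI)
      (auto simp: Zg hom_onD(2,3)[OF g_hom] hom_on_0[OF g_hom])
  have \<gamma>_eqI: "\<gamma> v = q" if "v \<in> Z" "q \<in> P1" "\<delta> q = \<alpha> v" for v q
    by (rule inj_onD[OF inj]) (use \<gamma>[OF that(1)] that in auto)
  have \<gamma>_hom: "hom_on (*s) free_scale Z P1 \<gamma>"
    unfolding hom_on_def
  proof (intro conjI ballI allI)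
    show "\<gamma> ` Z \<subseteq> P1" using \<gamma> by auto
    fix x assume x: "x \<in> Z"
    show "\<gamma> (c *s x) = free_scale c (\<gamma> x)" for c
      using x \<gamma>[OF x] sub1 subZ
      by (intro \<gamma>_eqI) (auto simp: rvec.subspace_scale free.subspace_scale hom_onD(3)[OF \<delta>] hom_onD(3)[OF \<alpha>_hom])
    fix y assume y: "y \<in> Z"
    show "\<gamma> (x + y) = \<gamma> x + \<gamma> y"
      using x y \<gamma>[OF x] \<gamma>[OF y] sub1 subZ
      by (intro \<gamma>_eqI) (auto simp: rvec.subspace_add free.subspace_add hom_onD(2)[OF \<delta>] hom_onD(2)[OF \<alpha>_hom])
  qed
  let ?T = "{\<phi> z *s w | \<phi> w. hom_on (*s) (*) Z UNIV \<phi> \<and> w \<in> Z}"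
  have TI: "\<phi> z *s w \<in> ?T" if "hom_on (*s) (*) Z UNIV \<phi>" "w \<in> Z" for \<phi> w
    using that by blast
  have "z - \<beta> (\<alpha> z) = (\<Sum>j\<in>UNIV. (z $ j) *s (axis j 1 - \<beta> (p j)))"
  proof -
    have "\<beta> (\<alpha> z) = (\<Sum>j\<in>UNIV. \<beta> (free_scale (z $ j) (p j)))"
      unfolding \<alpha>_def by (rule hom_on_sum[OF \<beta>_hom module_free_scale sub0])
        (intro free.subspace_scale sub0 p)
    moreover have "z = (\<Sum>j\<in>UNIV. (z $ j) *s axis j 1)"
      by (simp add: basis_expansion)
    ultimately show ?thesis
      by (simp add: hom_onD(3)[OF \<beta>_hom p(1)] rvec.scale_right_diff_distrib sum_subtractf)
  qed
  moreover have "(z $ j) *s (axis j 1 - \<beta> (p j)) \<in> ?T" for j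
  proof -
    have "axis j 1 - \<beta> (p j) \<in> Z"
      by (simp add: Zg hom_on_diff[OF g_hom module_vec] g_axis g\<beta>[OF p(1)] p)
    then show ?thesis
      by (intro TI[of "\<lambda>v. v $ j"]) (simp_all add: hom_on_def)
  qed
  ultimately have part1: "z - \<beta> (\<alpha> z) \<in> rvec.span ?T"
    by (simp only:) (rule rvec.span_sum, rule rvec.span_base, assumption)
  have \<beta>\<delta>\<pi>: "hom_on free_scale (*s) UNIV UNIV (\<lambda>y. \<beta> (\<delta> (\<pi>1 y)))"
    by (rule hom_on_compose[OF hom_on_compose[OF \<pi>1 \<delta>] \<beta>_hom])
  have "\<beta> (\<alpha> z) = \<beta> (\<delta> (\<pi>1 (\<iota>1 (\<gamma> z))))"
    using \<gamma>[OF z] by (simp add: id1)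
  also have "\<dots> = (\<Sum>b\<in>Poly_Mapping.keys (\<iota>1 (\<gamma> z)).
      coeff_at (\<iota>1 (\<gamma> z)) b *s \<beta> (\<delta> (\<pi>1 (Poly_Mapping.single b 1))))"
    by (rule hom_on_free_expansion[OF \<beta>\<delta>\<pi>])
  also have "\<dots> \<in> rvec.span ?T"
  proof (rule rvec.span_sum, rule rvec.span_base)
    fix b
    have "\<pi>1 (Poly_Mapping.single b 1) \<in> P1" by (rule hom_onD(1)[OF \<pi>1]) simp
    then have "\<delta> (\<pi>1 (Poly_Mapping.single b 1)) \<in> {x \<in> P0. \<epsilon> x = 0}" unfolding ker by blast
    then have "\<beta> (\<delta> (\<pi>1 (Poly_Mapping.single b 1))) \<in> Z"
      by (simp add: Zg g\<beta>)
    moreover have "hom_on (*s) (*) Z UNIV (\<lambda>v. coeff_at (\<iota>1 (\<gamma> v)) b)"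
      using hom_on_compose[OF \<gamma>_hom \<iota>1] by (auto simp: hom_on_def lookup_add)
    ultimately show "coeff_at (\<iota>1 (\<gamma> z)) b *s \<beta> (\<delta> (\<pi>1 (Poly_Mapping.single b 1))) \<in> ?T"
      by (intro TI)
  qed
  finally show ?thesis using rvec.span_add[OF part1] by fastforce
qed

section \<open>Algebraic independence and differentials\<close>

definition vars_in :: "'v set \<Rightarrow> ('v, 'k::zero) mpoly \<Rightarrow> bool" where
  "vars_in S H \<longleftrightarrow> (\<forall>t\<in>Poly_Mapping.keys H. Poly_Mapping.keys t \<subseteq> S)"

definition alg_independent :: "('u::finite \<Rightarrow> ('v, 'k::comm_ring_1) mpoly) \<Rightarrow> 'u set \<Rightarrow> bool" where
  "alg_independent g S \<longleftrightarrow> (\<forall>H. vars_in S H \<longrightarrow> poly_subst g H = 0 \<longrightarrow> H = 0)"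

lemma vars_in_0 [simp]: "vars_in S 0" by (simp add: vars_in_def)

lemma vars_in_add: "vars_in S p \<Longrightarrow> vars_in S q \<Longrightarrow> vars_in S (p + q)"
  using keys_add[of p q] unfolding vars_in_def by blast

lemma vars_in_mult:
  assumes "vars_in S p" "vars_in S q"
  shows "vars_in S (p * q)"
  unfolding vars_in_def
proof
  fix t assume "t \<in> Poly_Mapping.keys (p * q)"
  then obtain a b where "t = a + b" "a \<in> Poly_Mapping.keys p" "b \<in> Poly_Mapping.keys q"
    using keys_mult[of p q] by auto
  then show "Poly_Mapping.keys t \<subseteq> S"
    using assms keys_add[of a b] unfolding vars_in_def by blast
qed

lemma vars_in_const [simp]: "vars_in S (const c)"
  by (auto simp: vars_in_def const_def)

lemma vars_in_var [simp]: "vars_in S (var i) \<longleftrightarrow> i \<in> S"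
  by (auto simp: vars_in_def var_def)

lemma vars_in_poly_subst: "(\<And>u. vars_in S (h u)) \<Longrightarrow> vars_in S (poly_subst h H)"
  by (induction H rule: mpoly_ring_induct)
    (simp_all add: poly_subst_add poly_subst_mult vars_in_add vars_in_mult)

lemma vars_in_partial_deriv:
  assumes "vars_in S H" shows "vars_in S (partial_deriv i H)"
  unfolding vars_in_def
proof
  fix t assume "t \<in> Poly_Mapping.keys (partial_deriv i H)"
  then have "t + monom i 1 \<in> Poly_Mapping.keys H"
    by (auto simp: in_keys_iff lookup_partial_deriv)
  then have "Poly_Mapping.keys (t + monom i 1) \<subseteq> S" using assms unfolding vars_in_def by blast
  then show "Poly_Mapping.keys t \<subseteq> S" by (auto simp: in_keys_iff lookup_add)
qed

lemma partial_deriv_eq_0_if_not_in_vars: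
  assumes "vars_in S H" "i \<notin> S" shows "partial_deriv i H = 0"
proof (rule poly_mapping_eqI)
  fix t
  have "i \<in> Poly_Mapping.keys (t + monom i (1::nat))" by (simp add: in_keys_iff lookup_add)
  then have "t + monom i 1 \<notin> Poly_Mapping.keys H" using assms unfolding vars_in_def by blast
  then show "coeff_at (partial_deriv i H) t = coeff_at 0 t"
    by (simp add: lookup_partial_deriv in_keys_iff)
qed

lemma poly_subst_cong:
  assumes H: "vars_in S H" and eq: "\<And>u. u \<in> S \<Longrightarrow> g u = h u"
  shows "poly_subst g H = poly_subst h H"
  unfolding poly_subst_def
proof (intro sum.cong refl arg_cong2[where f = "(*)"] prod.cong)
  fix t j assume t: "t \<in> Poly_Mapping.keys H"
  show "g j ^ coeff_at t j = h j ^ coeff_at t j"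
  proof (cases "coeff_at t j = 0")
    case False
    then have "j \<in> Poly_Mapping.keys t" by (simp add: in_keys_iff)
    then have "j \<in> S" using H t unfolding vars_in_def by blast
    then show ?thesis by (simp add: eq)
  qed simp
qed

lemma vars_in_if_partial_deriv_0:
  fixes H :: "('v, 'k::field_char_0) mpoly"
  assumes "vars_in (insert w S) H" "partial_deriv w H = 0"
  shows "vars_in S H"
  unfolding vars_in_def
proof
  fix t assume t: "t \<in> Poly_Mapping.keys H"
  have "coeff_at t w = 0"
  proof (rule ccontr)
    assume "coeff_at t w \<noteq> 0"
    then have "t = t - monom w 1 + monom w 1"
      by (intro poly_mapping_eqI) (auto simp: lookup_add lookup_minus lookup_single when_def)
    moreover have "coeff_at (partial_deriv w H) (t - monom w 1) = 0" using assms(2) by simp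
    ultimately have "coeff_at H t = 0"
      by (simp add: lookup_partial_deriv del: of_nat_Suc)
    then show False using t by (simp add: in_keys_iff)
  qed
  then have "w \<notin> Poly_Mapping.keys t" by (simp add: in_keys_iff)
  then show "Poly_Mapping.keys t \<subseteq> S" using assms(1) t unfolding vars_in_def by blast
qed

text \<open>
  A nonzero relation \<open>H\<close> of least degree does it. Its derivative with respect to \<open>w\<close> is not the zero
  polynomial, since in characteristic zero \<open>H\<close> would then be a relation in \<open>S\<close> alone; and being of smaller
  degree, this derivative is no relation.
\<close>

lemma ex_separable_relation:
  fixes g :: "'u::finite \<Rightarrow> ('v, 'k::field_char_0) mpoly"
  assumes ind: "alg_independent g S" and dep: "\<not> alg_independent g (insert w S)"
  obtains H where "vars_in (insert w S) H" "poly_subst g H = 0" "poly_subst g (partial_deriv w H) \<noteq> 0"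
proof -
  define R where "R N H \<longleftrightarrow> H \<noteq> 0 \<and> vars_in (insert w S) H \<and> poly_subst g H = 0 \<and>
    (\<forall>t\<in>Poly_Mapping.keys H. exp_deg t \<le> N)" for N H
  obtain H0 where "H0 \<noteq> 0" "vars_in (insert w S) H0" "poly_subst g H0 = 0"
    using dep unfolding alg_independent_def by blast
  then have "R (Max (exp_deg ` Poly_Mapping.keys H0)) H0" unfolding R_def by simp
  then have ex: "\<exists>N. \<exists>H. R N H" by blast
  define N where "N = (LEAST N. \<exists>H. R N H)"
  obtain H where H: "R N H" using LeastI_ex[OF ex] unfolding N_def by blast
  have least: "\<not> R M G" if "M < N" for M G
    using that not_less_Least unfolding N_def by blast
  have vH: "vars_in (insert w S) H" using H by (simp add: R_def)
  have ne: "partial_deriv w H \<noteq> 0"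
  proof
    assume "partial_deriv w H = 0"
    then have "vars_in S H" using vars_in_if_partial_deriv_0[OF vH] by blast
    then show False using H ind unfolding R_def alg_independent_def by blast
  qed
  have deg: "exp_deg t < N" if "t \<in> Poly_Mapping.keys (partial_deriv w H)" for t
  proof -
    have "t + monom w 1 \<in> Poly_Mapping.keys H"
      using that by (auto simp: in_keys_iff lookup_partial_deriv)
    then have "exp_deg (t + monom w 1) \<le> N" using H unfolding R_def by blast
    then show ?thesis by simp
  qed
  obtain t where "t \<in> Poly_Mapping.keys (partial_deriv w H)"
    using ne by (metis ex_in_conv keys_eq_empty)
  then have "N - 1 < N" using deg by fastforce
  moreover have "\<forall>t\<in>Poly_Mapping.keys (partial_deriv w H). exp_deg t \<le> N - 1"
    using deg by fastforce
  ultimately have "poly_subst g (partial_deriv w H) \<noteq> 0"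
    using least[of "N - 1" "partial_deriv w H"] ne vars_in_partial_deriv[OF vH, of w] unfolding R_def by blast
  then show thesis using that vH H unfolding R_def by blast
qed

lemma ex_nontrivial_kernel:
  fixes m :: "'a \<Rightarrow> 'b \<Rightarrow> 'k::field"
  assumes "finite B" "finite A" "card B < card A"
  shows "\<exists>c. (\<exists>a\<in>A. c a \<noteq> 0) \<and> (\<forall>b\<in>B. (\<Sum>a\<in>A. c a * m a b) = 0)"
  using assms
proof (induction B arbitrary: A m rule: finite_induct)
  case empty
  then obtain a where "a \<in> A" by fastforce
  then show ?case by (intro exI[of _ "\<lambda>_. 1"]) auto
next
  case (insert b B)
  show ?case
  proof (cases "\<forall>a\<in>A. m a b = 0")
    case True
    then show ?thesis using insert.IH[of A m] insert.prems insert.hyps by auto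
  next
    case False
    then obtain a0 where a0: "a0 \<in> A" "m a0 b \<noteq> 0" by blast
    define A' where "A' = A - {a0}"
    have A: "A = insert a0 A'" "a0 \<notin> A'" "finite A'" using a0 insert.prems by (auto simp: A'_def)
    define m' where "m' a b' = m a b' - m a b / m a0 b * m a0 b'" for a b'
    have "card B < card A'" using insert A by simp
    then obtain c where c: "\<exists>a\<in>A'. c a \<noteq> 0" "\<forall>b'\<in>B. (\<Sum>a\<in>A'. c a * m' a b') = 0"
      using insert.IH[of A' m'] A(3) by blast
    define c' where "c' = c(a0 := - (\<Sum>a\<in>A'. c a * m a b) / m a0 b)"
    have sum: "(\<Sum>a\<in>A. c' a * m a b') = (\<Sum>a\<in>A'. c a * m' a b')" for b'
    proof -
      have "(\<Sum>a\<in>A'. c' a * m a b') = (\<Sum>a\<in>A'. c a * m a b')"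
        using A(2) by (intro sum.cong) (auto simp: c'_def)
      then show ?thesis
        using A by (simp add: c'_def m'_def right_diff_distrib sum_subtractf sum_divide_distrib
            sum_distrib_right mult.assoc divide_inverse)
    qed
    have "(\<Sum>a\<in>A'. c a * m' a b) = 0" using a0 by (simp add: m'_def)
    then have "\<forall>b'\<in>insert b B. (\<Sum>a\<in>A. c' a * m a b') = 0" using c(2) sum by simp
    moreover have "\<exists>a\<in>A. c' a \<noteq> 0" using c(1) A by (auto simp: c'_def)
    ultimately show ?thesis by blast
  qed
qed

text \<open>
  A count of dimensions. The monomials in \<open>S\<close> with exponents below \<open>N\<close> are \<open>N\<close> to the power \<open>card S\<close>
  in number, and at \<open>g\<close> they take values in a space of polynomials whose dimension is bounded by a
  multiple of \<open>N\<close> to the power \<open>CARD('n)\<close>. If \<open>S\<close> were larger than \<open>CARD('n)\<close>, these values would be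
  linearly dependent for large \<open>N\<close>.
\<close>

theorem card_alg_independent_le:
  fixes g :: "'u::finite \<Rightarrow> ('n::finite, 'k::field) mpoly"
  assumes ind: "alg_independent g S"
  shows "card S \<le> CARD('n)"
proof (rule ccontr)
  assume "\<not> card S \<le> CARD('n)"
  then have s: "Suc CARD('n) \<le> card S" by simp
  define e where "e = Max (exp_deg ` (\<Union>u. Poly_Mapping.keys (g u)))"
  have e: "deg_le e (g u)" for u
    unfolding deg_le_def e_def by (auto intro!: Max_ge)
  \<comment> \<open>At \<open>g\<close> the monomials with exponents below \<open>N\<close> have degree at most \<open>e * card S * (N - 1) < M * N\<close>, and \<open>N > M ^ CARD('n)\<close> makes the count exceed the dimension.\<close>
  define M where "M = e * card S + 1"
  define N where "N = M ^ CARD('n) + 1"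
  have N: "M ^ CARD('n) < N" "1 \<le> N" "1 \<le> M" by (auto simp: N_def M_def)
  define A where "A = PiE S (\<lambda>_. {..<N})"
  define B where "B = PiE (UNIV :: 'n set) (\<lambda>_. {..<M * N})"
  have fin: "finite A" "finite B" by (auto simp: A_def B_def intro!: finite_PiE)
  have "card B = (M * N) ^ CARD('n)" by (simp add: B_def card_PiE)
  also have "\<dots> = M ^ CARD('n) * N ^ CARD('n)" by (simp add: power_mult_distrib)
  also have "\<dots> < N * N ^ CARD('n)" using N by (intro mult_strict_right_mono) auto
  also have "\<dots> = N ^ Suc CARD('n)" by simp
  also have "\<dots> \<le> N ^ card S" using N s by (intro power_increasing)
  also have "\<dots> = card A" by (simp add: A_def card_PiE)
  finally have card: "card B < card A" .
  define T where "T h = (\<Sum>u\<in>S. monom u (h u))" for h :: "'u \<Rightarrow> nat"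
  have T: "coeff_at (T h) u = (if u \<in> S then h u else 0)" for h u
  proof -
    have "coeff_at (T h) u = (\<Sum>v\<in>S. if v = u then h v else 0)"
      unfolding T_def lookup_sum by (intro sum.cong) (auto simp: lookup_single when_def)
    then show ?thesis by simp
  qed
  define G where "G h = poly_subst g (monom (T h) 1)" for h
  have deg: "deg_le (e * (card S * (N - 1))) (G h)" if "h \<in> A" for h
  proof -
    have "G h = (\<Prod>u\<in>UNIV. g u ^ coeff_at (T h) u)"
      by (simp add: G_def poly_subst_monom)
    moreover have "deg_le (\<Sum>u\<in>UNIV. e * coeff_at (T h) u) (\<Prod>u\<in>UNIV. g u ^ coeff_at (T h) u)"
      by (intro deg_le_prod deg_le_power e)
    moreover have "(\<Sum>u\<in>UNIV. e * coeff_at (T h) u) = e * (\<Sum>u\<in>S. h u)"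
      by (simp add: T sum_distrib_left if_distrib sum.If_cases cong: if_cong)
    moreover have "h u \<le> N - 1" if "u \<in> S" for u
      using PiE_mem[OF \<open>h \<in> A\<close>[unfolded A_def] that] by simp
    then have "(\<Sum>u\<in>S. h u) \<le> card S * (N - 1)"
      using sum_bounded_above[of S h "N - 1"] by simp
    ultimately show ?thesis
      by (fastforce simp: deg_le_def intro: order_trans mult_le_mono2)
  qed
  have bound: "e * (card S * (N - 1)) < M * N"
  proof -
    have "e * (card S * (N - 1)) \<le> (e * card S) * N" by (simp add: mult.assoc)
    also have "\<dots> < M * N" using N by (simp add: M_def)
    finally show ?thesis .
  qed
  obtain c where c: "\<exists>h\<in>A. c h \<noteq> 0"
    and c0: "\<And>b. b \<in> B \<Longrightarrow> (\<Sum>h\<in>A. c h * coeff_at (G h) (Abs_poly_mapping b)) = 0"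
    using ex_nontrivial_kernel[OF fin(2,1) card, of "\<lambda>h b. coeff_at (G h) (Abs_poly_mapping b)"] by blast
  define H where "H = (\<Sum>h\<in>A. monom (T h) (c h))"
  have GH: "poly_subst g H = (\<Sum>h\<in>A. const (c h) * G h)"
    by (simp add: H_def G_def poly_subst_sum poly_subst_monom)
  have "poly_subst g H = 0"
  proof (rule poly_mapping_eqI)
    fix t
    have "(\<Sum>h\<in>A. c h * coeff_at (G h) t) = 0"
    proof (cases "coeff_at t \<in> B")
      case True
      then show ?thesis using c0[OF True] by simp
    next
      case False
      then obtain i where i: "M * N \<le> coeff_at t i" by (auto simp: B_def PiE_UNIV_domain Pi_def not_less)
      have "coeff_at t i \<le> exp_deg t" unfolding exp_deg_UNIV by (rule member_le_sum) auto
      then have "e * (card S * (N - 1)) < exp_deg t" using bound i by simp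
      then have "coeff_at (G h) t = 0" if "h \<in> A" for h
        using deg[OF that] unfolding deg_le_def by (meson in_keys_iff not_le)
      then show ?thesis by simp
    qed
    then show "coeff_at (poly_subst g H) t = coeff_at 0 t" by (simp add: GH lookup_sum)
  qed
  moreover have "vars_in S H"
    unfolding vars_in_def
  proof
    fix t assume "t \<in> Poly_Mapping.keys H"
    then obtain h where "t = T h"
      unfolding H_def using keys_sum[of "\<lambda>h. monom (T h) (c h)" A] by (auto split: if_splits)
    then show "Poly_Mapping.keys t \<subseteq> S" by (auto simp: in_keys_iff T split: if_splits)
  qed
  ultimately have "H = 0" using ind unfolding alg_independent_def by blast
  have "c h = 0" if h: "h \<in> A" for h
  proof -
    have inj: "T h' = T h \<longleftrightarrow> h' = h" if "h' \<in> A" for h'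
    proof
      assume eq: "T h' = T h"
      show "h' = h"
      proof
        fix u show "h' u = h u"
          using arg_cong[OF eq, of "\<lambda>t. coeff_at t u"] that h
          by (cases "u \<in> S") (auto simp: T A_def PiE_def extensional_def)
      qed
    qed simp
    have "coeff_at H (T h) = (\<Sum>h'\<in>A. if h' = h then c h' else 0)"
      unfolding H_def lookup_sum by (intro sum.cong) (auto simp: lookup_single inj when_def)
    then show ?thesis using \<open>H = 0\<close> h fin by simp
  qed
  then show False using c by blast
qed

text \<open>
  A generating family of at most \<open>n\<close> vectors in an \<open>n\<close>-dimensional space is independent. Over a domain
  this is seen on determinants: if \<open>Ym\<close> has the vectors \<open>Y u\<close> as rows, padded with zero rows, and the
  rows of \<open>X\<close> are the coefficients \<open>a\<close>, then \<open>X ** Ym\<close> is diagonal with nonzero entries. So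
  \<open>det Ym \<noteq> 0\<close>, and a linear relation between the rows has coefficient zero at \<open>u0\<close> because
  the determinant is multilinear and alternating in the rows.
\<close>

lemma independent_if_card_le_and_spanning:
  fixes Y :: "'u \<Rightarrow> 'r::comm_ring_1 ^ 'n::finite"
  assumes dom: "\<And>a b :: 'r. a * b = 0 \<Longrightarrow> a = 0 \<or> b = 0"
    and S: "finite S" "card S \<le> CARD('n)"
    and span: "\<And>i. \<exists>c a. c \<noteq> 0 \<and> (\<Sum>u\<in>S. a u *s Y u) = axis i c"
    and z: "(\<Sum>u\<in>S. z u *s Y u) = 0" and u0: "u0 \<in> S"
  shows "z u0 = 0"
proof -
  obtain e :: "'u \<Rightarrow> 'n" where e: "inj_on e S"
    using card_le_inj[OF S(1), of "UNIV :: 'n set"] S(2) by auto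
  obtain c a where c: "\<And>i. c i \<noteq> 0" and a: "\<And>i. (\<Sum>u\<in>S. a i u *s Y u) = axis i (c i)"
    using span by metis
  define Ym :: "'r ^ 'n ^ 'n" where "Ym = (\<chi> k. if k \<in> e ` S then Y (the_inv_into S e k) else 0)"
  define X :: "'r ^ 'n ^ 'n" where "X = (\<chi> i k. if k \<in> e ` S then a i (the_inv_into S e k) else 0)"
  have Ym: "Ym $ e u = Y u" if "u \<in> S" for u
    using that by (simp add: Ym_def the_inv_into_f_f[OF e])
  have X: "X $ i $ e u = a i u" if "u \<in> S" for i u
    using that by (simp add: X_def the_inv_into_f_f[OF e])
  have XY: "(X ** Ym) $ i $ j = axis i (c i) $ j" for i j
  proof -
    have "(X ** Ym) $ i $ j = (\<Sum>k\<in>UNIV. X $ i $ k * Ym $ k $ j)"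
      by (simp add: matrix_matrix_mult_def)
    also have "\<dots> = (\<Sum>k\<in>e ` S. X $ i $ k * Ym $ k $ j)"
      by (rule sum.mono_neutral_right) (auto simp: X_def)
    also have "\<dots> = (\<Sum>u\<in>S. a i u * Y u $ j)"
      by (simp add: sum.reindex[OF e] X Ym)
    also have "\<dots> = (\<Sum>u\<in>S. a i u *s Y u) $ j" by simp
    finally show ?thesis by (simp add: a)
  qed
  have "det X * det Ym = (\<Prod>i\<in>UNIV. (X ** Ym) $ i $ i)"
    unfolding det_mul[symmetric] by (rule det_diagonal) (simp add: XY axis_def)
  also have "\<dots> = prod c UNIV" by (simp add: XY axis_def)
  finally have "det X * det Ym = prod c UNIV" .
  moreover have "prod c K \<noteq> 0" if "finite K" for K
    using that by induction (use dom c in auto)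
  ultimately have detY: "det Ym \<noteq> 0" by (metis finite_class.finite_UNIV mult_zero_right)
  have row0: "det ((\<chi> k. if k = e u0 then Y u else Ym $ k) :: 'r ^ 'n ^ 'n) = (if u = u0 then det Ym else 0)"
    if "u \<in> S" for u
  proof (cases "u = u0")
    case True
    then have "((\<chi> k. if k = e u0 then Y u else Ym $ k) :: 'r ^ 'n ^ 'n) = Ym"
      using that by (auto simp: vec_eq_iff Ym)
    then show ?thesis using True by simp
  next
    case False
    then have "e u \<noteq> e u0" using e that u0 by (auto dest: inj_onD)
    then have "det ((\<chi> k. if k = e u0 then Y u else Ym $ k) :: 'r ^ 'n ^ 'n) = 0"
      by (intro det_identical_rows[of "e u0" "e u"]) (auto simp: row_def vec_eq_iff Ym that)
    then show ?thesis using False by simp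
  qed
  have "0 = det ((\<chi> k. if k = e u0 then \<Sum>u\<in>S. z u *s Y u else Ym $ k) :: 'r ^ 'n ^ 'n)"
    unfolding z by (simp add: det_row_0)
  also have "\<dots> = (\<Sum>u\<in>S. z u * det ((\<chi> k. if k = e u0 then Y u else Ym $ k) :: 'r ^ 'n ^ 'n))"
    using det_linear_row_sum[OF S(1), of "e u0" "\<lambda>_ u. z u *s Y u" "\<lambda>k. Ym $ k"]
      det_row_mul[of "e u0" _ "\<lambda>_. Y _" "\<lambda>k. Ym $ k"] by simp
  also have "\<dots> = z u0 * det Ym"
    using u0 S(1) by (simp add: row0 if_distrib cong: if_cong)
  finally show ?thesis using dom detY by metis
qed

text \<open>
  So an independent subfamily remains independent when the whole family is extended by further
  elements.
\<close>

lemma alg_independent_image: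
  fixes g :: "'u::finite \<Rightarrow> ('v, 'k::comm_ring_1) mpoly" and \<iota> :: "'a::finite \<Rightarrow> 'u"
  assumes "inj \<iota>" and ind: "alg_independent (\<lambda>j. g (\<iota> j)) C"
  shows "alg_independent g (\<iota> ` C)"
  unfolding alg_independent_def
proof (intro allI impI)
  fix H assume H: "vars_in (\<iota> ` C) H" "poly_subst g H = 0"
  define h :: "'u \<Rightarrow> ('a, 'k) mpoly" where "h u = (if u \<in> \<iota> ` C then var (inv \<iota> u) else 0)" for u
  have h: "h (\<iota> j) = var j" if "j \<in> C" for j
    using that assms(1) by (auto simp: h_def)
  have "vars_in C (poly_subst h H)"
    by (rule vars_in_poly_subst) (use assms(1) in \<open>auto simp: h_def\<close>)
  moreover have "poly_subst (\<lambda>j. g (\<iota> j)) (poly_subst h H) = poly_subst g H"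
    unfolding poly_subst_poly_subst by (rule poly_subst_cong[OF H(1)]) (auto simp: h)
  ultimately have "poly_subst h H = 0" using ind H(2) unfolding alg_independent_def by metis
  then have "poly_subst (\<lambda>j. var (\<iota> j)) (poly_subst h H) = (0 :: ('u, 'k) mpoly)" by simp
  also have "poly_subst (\<lambda>j. var (\<iota> j)) (poly_subst h H) = poly_subst var H"
    unfolding poly_subst_poly_subst by (rule poly_subst_cong[OF H(1)]) (auto simp: h)
  finally show "H = 0" by simp
qed

lemma ex_maximal_alg_independent:
  assumes "alg_independent g C"
  obtains S where "C \<subseteq> S" "alg_independent g S" "\<And>w. w \<notin> S \<Longrightarrow> \<not> alg_independent g (insert w S)"
proof -
  obtain S where S: "S \<in> {S. C \<subseteq> S \<and> alg_independent g S}"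
    and max: "\<forall>T\<in>{S. C \<subseteq> S \<and> alg_independent g S}. S \<subseteq> T \<longrightarrow> S = T"
    using finite_has_maximal2[of "{S. C \<subseteq> S \<and> alg_independent g S}" C] assms by auto
  then show thesis using that[of S] by blast
qed

text \<open>
  Enlarge the independent family by variables \<open>x\<^sub>i\<close> to a maximal one, \<open>S\<close>. Each remaining variable is
  separably algebraic over \<open>S\<close>, and differentiating its relation expresses a nonzero multiple of
  \<open>dx\<^sub>i\<close> by the differentials of \<open>S\<close>. These are at most \<open>n\<close> vectors that span an \<open>n\<close>-dimensional space,
  so they are linearly independent.
\<close>

theorem jacobian_criterion:
  fixes f :: "'m::finite \<Rightarrow> ('n::finite, 'k::field_char_0) mpoly"
  assumes ind: "alg_independent f C" and z: "(\<Sum>j\<in>C. z j *s differential (f j)) = 0" and "j \<in> C"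
  shows "z j = 0"
proof -
  define g :: "'m + 'n \<Rightarrow> ('n, 'k) mpoly" where "g = case_sum f var"
  have "alg_independent g (Inl ` C)"
    by (rule alg_independent_image) (use ind in \<open>simp_all add: g_def\<close>)
  then obtain S where S: "Inl ` C \<subseteq> S" "alg_independent g S"
    and max: "\<And>w. w \<notin> S \<Longrightarrow> \<not> alg_independent g (insert w S)"
    by (rule ex_maximal_alg_independent) blast
  have "\<exists>c a. c \<noteq> 0 \<and> (\<Sum>u\<in>S. a u *s differential (g u)) = axis i c" for i
  proof -
    have dx: "differential (g (Inr i)) = axis i 1"
      by (auto simp: g_def differential_def vec_eq_iff axis_def partial_deriv_var)
    show ?thesis
    proof (cases "Inr i \<in> S")
      case True
      have "(\<Sum>u\<in>S. (if u = Inr i then 1 else 0) *s differential (g u)) =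
        (\<Sum>u\<in>S. if u = Inr i then differential (g u) else 0)"
        by (intro sum.cong) auto
      then show ?thesis using True dx by (intro exI[of _ 1] exI[of _ "\<lambda>u. if u = Inr i then 1 else 0"]) simp
    next
      case False
      obtain H where H: "vars_in (insert (Inr i) S) H" "poly_subst g H = 0"
        "poly_subst g (partial_deriv (Inr i) H) \<noteq> 0"
        using ex_separable_relation[OF S(2) max[OF False]] by blast
      let ?a = "\<lambda>u. poly_subst g (partial_deriv u H)"
      have "0 = (\<Sum>u\<in>UNIV. ?a u *s differential (g u))"
        using chain_rule[of _ g H] H(2) by (simp add: vec_eq_iff differential_def)
      also have "\<dots> = (\<Sum>u\<in>insert (Inr i) S. ?a u *s differential (g u))"
        by (rule sum.mono_neutral_right) (auto simp: partial_deriv_eq_0_if_not_in_vars[OF H(1)])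
      also have "\<dots> = ?a (Inr i) *s axis i 1 + (\<Sum>u\<in>S. ?a u *s differential (g u))"
        using False by (simp add: dx)
      finally have "(\<Sum>u\<in>S. ?a u *s differential (g u)) = - (?a (Inr i) *s axis i 1)"
        by (simp add: eq_neg_iff_add_eq_0 add.commute)
      also have "\<dots> = axis i (- ?a (Inr i))" by (auto simp: vec_eq_iff axis_def)
      finally show ?thesis using H(3) by (intro exI[of _ "- ?a (Inr i)"] exI[of _ ?a]) simp
    qed
  qed
  note span = this
  define z' where "z' u = (case u of Inl j \<Rightarrow> if j \<in> C then z j else 0 | Inr _ \<Rightarrow> 0)" for u :: "'m + 'n"
  have "(\<Sum>u\<in>S. z' u *s differential (g u)) = (\<Sum>u\<in>Inl ` C. z' u *s differential (g u))"
    using S(1) by (intro sum.mono_neutral_right) (auto simp: z'_def split: sum.splits)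
  also have "\<dots> = (\<Sum>j\<in>C. z j *s differential (f j))"
    by (simp add: sum.reindex z'_def g_def)
  finally have z': "(\<Sum>u\<in>S. z' u *s differential (g u)) = 0" using z by simp
  have "z' (Inl j) = 0"
    by (rule independent_if_card_le_and_spanning[OF _ _ card_alg_independent_le[OF S(2)] span z'])
      (use S(1) \<open>j \<in> C\<close> in auto)
  then show ?thesis using \<open>j \<in> C\<close> by (simp add: z'_def)
qed

lemma subspace_differential_syzygies: "rvec.subspace (differential_syzygies f)"
  by (rule rvec.subspaceI)
    (auto simp: differential_syzygies_def rvec.scale_left_distrib sum.distrib simp flip: rvec.scale_scale rvec.scale_sum_right)

lemma polar_subset_differential_syzygies: "polar_syzygies f \<subseteq> differential_syzygies f"
  unfolding polar_syzygies_def
proof (rule rvec.span_minimal[OF _ subspace_differential_syzygies], clarify)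
  fix F assume "F \<in> relation_ideal f"
  then have "poly_subst f F = 0" by (simp add: relation_ideal_def)
  then show "(\<chi> j. poly_subst f (partial_deriv j F)) \<in> differential_syzygies f"
    using chain_rule[of _ f F] by (simp add: differential_syzygies_def differential_def vec_eq_iff)
qed

text \<open>
  Let \<open>C\<close> index a maximal algebraically independent subfamily of \<open>f\<close>. For \<open>j \<notin> C\<close> a separable relation
  in \<open>C\<close> and \<open>j\<close> yields a polar syzygy whose only nonzero entry outside \<open>C\<close> is the one at \<open>j\<close>. With
  these, all entries of a multiple of \<open>z\<close> outside \<open>C\<close> are cleared. What remains is a linear relation
  between the differentials of an algebraically independent family, which is trivial.
\<close>

theorem polar_syzygies_full_rank:
  fixes f :: "'m::finite \<Rightarrow> ('n::finite, 'k::field_char_0) mpoly"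
  assumes z: "z \<in> differential_syzygies f"
  shows "\<exists>c. c \<noteq> 0 \<and> c *s z \<in> polar_syzygies f"
proof -
  have "alg_independent f {}"
    unfolding alg_independent_def
  proof (intro allI impI)
    fix H :: "('m, 'k) mpoly" assume H: "vars_in {} H" "poly_subst f H = 0"
    have "coeff_at H t = 0" if "t \<noteq> 0" for t
      using H(1) that by (auto simp: vars_in_def in_keys_iff)
    then have "H = const (coeff_at H 0)"
      by (intro poly_mapping_eqI) (auto simp: const_def lookup_single when_def)
    then show "H = 0" using H(2) by (metis const_eq_0_iff poly_subst_const)
  qed
  then obtain C where C: "alg_independent f C" and max: "\<And>w. w \<notin> C \<Longrightarrow> \<not> alg_independent f (insert w C)"
    by (rule ex_maximal_alg_independent) blast
  have "\<exists>c y. c \<noteq> 0 \<and> y \<in> polar_syzygies f \<and> (\<forall>j\<in>W. (c *s z - y) $ j = 0)"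
    if "finite W" "W \<inter> C = {}" for W
    using that
  proof (induction W)
    case empty
    show ?case by (intro exI[of _ 1] exI[of _ 0]) (simp add: polar_syzygies_def rvec.span_zero)
  next
    case (insert j W)
    then obtain c y where c: "c \<noteq> 0" and y: "y \<in> polar_syzygies f" and W: "\<forall>j\<in>W. (c *s z - y) $ j = 0"
      by auto
    have "j \<notin> C" using insert.prems by simp
    then obtain H where H: "vars_in (insert j C) H" "poly_subst f H = 0" and D: "poly_subst f (partial_deriv j H) \<noteq> 0"
      using ex_separable_relation[OF C max] by metis
    define v :: "('n, 'k) mpoly ^ 'm" where "v = (\<chi> j. poly_subst f (partial_deriv j H))"
    have "v \<in> polar_syzygies f"
      unfolding polar_syzygies_def v_def using H(2) by (intro rvec.span_base) (auto simp: relation_ideal_def)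
    then have y': "v $ j *s y + (c *s z - y) $ j *s v \<in> polar_syzygies f"
      using y unfolding polar_syzygies_def by (intro rvec.span_add rvec.span_scale)
    have vW: "v $ l = 0" if "l \<in> W" for l
      using that insert.prems insert.hyps
      by (auto simp: v_def intro!: arg_cong[of _ 0 "poly_subst f", simplified] partial_deriv_eq_0_if_not_in_vars[OF H(1)])
    have "\<forall>l\<in>insert j W. ((v $ j * c) *s z - (v $ j *s y + (c *s z - y) $ j *s v)) $ l = 0"
    proof
      fix l assume l: "l \<in> insert j W"
      have "((v $ j * c) *s z - (v $ j *s y + (c *s z - y) $ j *s v)) $ l =
        v $ j * (c *s z - y) $ l - (c *s z - y) $ j * v $ l"
        by (simp add: algebra_simps)
      also have "\<dots> = 0" using l W vW by (cases "l = j") auto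
      finally show "((v $ j * c) *s z - (v $ j *s y + (c *s z - y) $ j *s v)) $ l = 0" .
    qed
    moreover have "v $ j * c \<noteq> 0" using c D by (simp add: v_def)
    ultimately show ?case using y' by blast
  qed
  from this[of "- C"] obtain c y where c: "c \<noteq> 0" and y: "y \<in> polar_syzygies f"
    and cy: "\<And>j. j \<notin> C \<Longrightarrow> (c *s z - y) $ j = 0" by auto
  define z' where "z' = c *s z - y"
  have "z' \<in> differential_syzygies f"
    unfolding z'_def using y polar_subset_differential_syzygies z
    by (intro rvec.subspace_diff rvec.subspace_scale subspace_differential_syzygies) auto
  then have "0 = (\<Sum>j\<in>UNIV. z' $ j *s differential (f j))" by (simp add: differential_syzygies_def)
  also have "\<dots> = (\<Sum>j\<in>C. z' $ j *s differential (f j))"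
    by (rule sum.mono_neutral_right) (auto simp: z'_def cy simp del: vector_minus_component)
  finally have "z' $ j = 0" if "j \<in> C" for j
    using jacobian_criterion[OF C _ that, of "\<lambda>j. z' $ j"] by simp
  then have "z' = 0" using cy by (metis vec_eq_iff z'_def zero_index)
  then show ?thesis using c y by (auto simp: z'_def)
qed

section \<open>Syzygies of quadrics\<close>

definition vec_hcomp :: "nat \<Rightarrow> ('v, 'k::comm_monoid_add) mpoly ^ 'm \<Rightarrow> ('v, 'k) mpoly ^ 'm" where
  "vec_hcomp d z = (\<chi> j. hcomp d (z $ j))"

definition polar_vector :: "('m::finite \<Rightarrow> ('n::finite, 'k::comm_ring_1) mpoly) \<Rightarrow> ('m, 'k) mpoly \<Rightarrow> ('n, 'k) mpoly ^ 'm" where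
  "polar_vector f F = (\<chi> j. poly_subst f (partial_deriv j F))"

lemma differential_syzygies_iff:
  "z \<in> differential_syzygies f \<longleftrightarrow> (\<forall>i. (\<Sum>j\<in>UNIV. z $ j * partial_deriv i (f j)) = 0)"
  by (simp add: differential_syzygies_def differential_def vec_eq_iff)

lemma polar_vector_in_polar: "F \<in> relation_ideal f \<Longrightarrow> polar_vector f F \<in> polar_syzygies f"
  unfolding polar_syzygies_def polar_vector_def by (intro rvec.span_base) blast

lemma relation_ideal_prime:
  fixes f :: "'m::finite \<Rightarrow> ('n::finite, 'k::field) mpoly"
  shows "a * b \<in> relation_ideal f \<Longrightarrow> a \<in> relation_ideal f \<or> b \<in> relation_ideal f"
  by (simp add: relation_ideal_def poly_subst_mult)

lemma hcomp_homogeneous_ideal: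
  fixes F :: "nat \<Rightarrow> ('v::finite, 'k::comm_ring_1) mpoly"
  assumes "\<And>i. i \<in> I \<Longrightarrow> is_form d (F i)" "x \<in> ideal.span (F ` I)"
  shows "hcomp e x \<in> ideal.span (F ` I)"
  using assms(2)
proof (induction rule: ideal.span_induct_alt)
  case base
  show ?case by (simp add: ideal.span_zero)
next
  case (step c x y)
  then have "is_form d x" using assms(1) by auto
  then have "hcomp e (c * x) \<in> ideal.span (F ` I)"
    using step by (auto simp: hcomp_mult_form intro: ideal.span_scale ideal.span_base ideal.span_zero)
  then show ?case using step by (simp add: hcomp_add ideal.span_add)
qed

lemma minimal_generators_independent:
  fixes F :: "nat \<Rightarrow> ('v::finite, 'k::field) mpoly"
  assumes G: "minimally_generates G P" and F: "bij_betw F {..<r} G"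
    and c: "(\<Sum>i<r. const (c i) * F i) = 0" and l: "l < r"
  shows "c l = 0"
proof (rule ccontr)
  assume cl: "c l \<noteq> 0"
  let ?H = "G - {F l}"
  have FG: "F i \<in> G" if "i < r" for i using F that by (auto simp: bij_betw_def)
  have "(\<Sum>i<r. const (c i) * F i) = const (c l) * F l + (\<Sum>i\<in>{..<r} - {l}. const (c i) * F i)"
    using l by (subst sum.remove[of _ l]) auto
  then have Fl: "const (c l) * F l = - (\<Sum>i\<in>{..<r} - {l}. const (c i) * F i)"
    using c by (simp add: eq_neg_iff_add_eq_0)
  have FH: "F i \<in> ?H" if "i \<in> {..<r} - {l}" for i
    using that FG F l by (auto simp: bij_betw_def dest: inj_onD)
  have "const (c l) * F l \<in> ideal.span ?H"
    unfolding Fl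
    by (rule ideal.span_neg, rule ideal.span_sum, rule ideal.span_scale, rule ideal.span_base, rule FH)
  from ideal.span_scale[OF this, of "const (1 / c l)"]
  have "F l \<in> ideal.span ?H" using cl by (simp add: mult.assoc[symmetric] const_mult[symmetric])
  then have "G \<subseteq> ideal.span ?H" by (auto intro: ideal.span_base)
  then have "ideal.span G \<subseteq> ideal.span ?H" by (intro ideal.span_minimal) auto
  moreover have "ideal.span ?H \<subseteq> ideal.span G" by (intro ideal.span_mono) auto
  ultimately have "gen_ideal ?H = P" using G by (simp add: minimally_generates_def gen_ideal_def)
  moreover have "?H \<subset> G" using FG[OF l] by blast
  ultimately show False using G by (simp add: minimally_generates_def)
qed

locale quadric_family =
  fixes f :: "'m::finite \<Rightarrow> ('n::finite, 'k::field_char_0) mpoly"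
  assumes forms: "\<And>j. is_form 2 (f j)"
    and lin_indep: "\<And>c :: 'm \<Rightarrow> 'k. (\<Sum>j\<in>UNIV. const (c j) * f j) = 0 \<Longrightarrow> \<forall>j. c j = 0"
begin

abbreviation "Z \<equiv> differential_syzygies f"

lemma forms_deriv: "is_form 1 (partial_deriv i (f j))"
  using is_form_partial_deriv[of 1 "f j" i] forms by (simp add: numeral_2_eq_2)

lemma vec_hcomp_in_Z: assumes "z \<in> Z" shows "vec_hcomp d z \<in> Z"
proof -
  have "(\<Sum>j\<in>UNIV. hcomp d (z $ j) * partial_deriv i (f j)) = hcomp (Suc d) (\<Sum>j\<in>UNIV. z $ j * partial_deriv i (f j))" for i
    by (simp add: hcomp_sum hcomp_mult_form[OF forms_deriv])
  then show ?thesis using assms by (simp add: differential_syzygies_iff vec_hcomp_def)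
qed

text \<open>
  Contraction with the Euler vector field maps \<open>df\<^sub>j\<close> to \<open>2 f\<^sub>j\<close>.
\<close>

lemma syzygy_contraction: assumes "z \<in> Z" shows "(\<Sum>j\<in>UNIV. z $ j * f j) = 0"
proof -
  have "of_nat 2 * (\<Sum>j\<in>UNIV. z $ j * f j) = (\<Sum>j\<in>UNIV. z $ j * (of_nat 2 * f j))"
    by (simp add: sum_distrib_left ac_simps)
  also have "\<dots> = (\<Sum>j\<in>UNIV. \<Sum>i\<in>UNIV. var i * (z $ j * partial_deriv i (f j)))"
    unfolding euler[OF forms, symmetric] by (simp add: sum_distrib_left ac_simps)
  also have "\<dots> = (\<Sum>i\<in>UNIV. var i * (\<Sum>j\<in>UNIV. z $ j * partial_deriv i (f j)))"
    unfolding sum_distrib_left by (rule sum.swap)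
  also have "\<dots> = 0" using assms by (simp add: differential_syzygies_iff)
  finally show ?thesis by (rule of_nat_mult_eq_0_mpoly) simp
qed

lemma constant_relation_0:
  assumes "\<And>j. is_form 0 (l j)" "(\<Sum>j\<in>UNIV. l j * f j) = 0" shows "l j = 0"
proof -
  have c: "l j = const (coeff_at (l j) 0)" for j using assms(1) by (rule is_form_0_eq_const)
  have "(\<Sum>j\<in>UNIV. const (coeff_at (l j) 0) * f j) = (\<Sum>j\<in>UNIV. l j * f j)"
    using c by (intro sum.cong) auto
  then have "(\<Sum>j\<in>UNIV. const (coeff_at (l j) 0) * f j) = 0" using assms(2) by simp
  from lin_indep[OF this] have "coeff_at (l j) 0 = 0" by blast
  then show ?thesis using c[of j] by simp
qed

text \<open>
  If \<open>z\<close> is of degree 0, then \<open>\<Sum>\<^sub>j z\<^sub>j f\<^sub>j = 0\<close> has constant coefficients, which vanish by linear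
  independence. In degree 1, differentiating \<open>\<Sum>\<^sub>j z\<^sub>j f\<^sub>j = 0\<close> and using that \<open>z\<close> is a syzygy leaves
  \<open>\<Sum>\<^sub>j (\<partial>\<^sub>i z\<^sub>j) f\<^sub>j = 0\<close>, so that all derivatives \<open>\<partial>\<^sub>i z\<^sub>j\<close> vanish.
\<close>

lemma order_syzygies: assumes "z \<in> Z" shows "order_ge 2 (z $ j)"
proof (rule order_geI)
  fix d :: nat assume "d < 2"
  then consider "d = 0" | "d = 1" by linarith
  then show "hcomp d (z $ j) = 0"
  proof cases
    case 1
    show ?thesis unfolding 1
      by (rule constant_relation_0[of "\<lambda>j. hcomp 0 (z $ j)"])
        (use syzygy_contraction[OF vec_hcomp_in_Z[OF assms, of 0]] in \<open>simp_all add: vec_hcomp_def\<close>)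
  next
    case 2
    define l where "l j = hcomp 1 (z $ j)" for j
    have lZ: "vec_hcomp 1 z \<in> Z" by (rule vec_hcomp_in_Z[OF assms])
    have "partial_deriv i (l j) = 0" for i j
    proof (rule constant_relation_0[of "\<lambda>j. partial_deriv i (l j)"])
      show "is_form 0 (partial_deriv i (l j))" for j
        by (rule is_form_partial_deriv) (simp add: l_def)
      have "0 = partial_deriv i (\<Sum>j\<in>UNIV. l j * f j)"
        using syzygy_contraction[OF lZ] by (simp add: vec_hcomp_def l_def)
      also have "\<dots> = (\<Sum>j\<in>UNIV. partial_deriv i (l j) * f j) + (\<Sum>j\<in>UNIV. l j * partial_deriv i (f j))"
        by (simp add: partial_deriv_sum partial_deriv_mult sum.distrib)
      also have "(\<Sum>j\<in>UNIV. l j * partial_deriv i (f j)) = 0"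
        using lZ by (simp add: differential_syzygies_iff vec_hcomp_def l_def)
      finally show "(\<Sum>j\<in>UNIV. partial_deriv i (l j) * f j) = 0" by simp
    qed
    then show ?thesis
      using form_eq_0_if_partial_derivs_0[of 0 "l j"] by (simp add: 2 l_def)
  qed
qed

lemma is_form_polar_vector: "is_form 2 F \<Longrightarrow> is_form 2 (polar_vector f F $ j)"
  using is_form_poly_subst[OF is_form_partial_deriv[of 1 F j] forms] 
  by (simp add: polar_vector_def numeral_2_eq_2)

lemma linear_form_relation_0:
  assumes "is_form 1 L" "poly_subst f L = 0" shows "L = 0"
proof -
  have c: "is_form 0 (partial_deriv j L)" for j using assms(1) by (intro is_form_partial_deriv) simp
  have L: "(\<Sum>j\<in>UNIV. var j * partial_deriv j L) = L" using euler[OF assms(1)] by simp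
  have "(\<Sum>j\<in>UNIV. poly_subst f (partial_deriv j L) * f j) = poly_subst f (\<Sum>j\<in>UNIV. var j * partial_deriv j L)"
    by (simp add: poly_subst_sum poly_subst_mult mult.commute)
  then have rel: "(\<Sum>j\<in>UNIV. poly_subst f (partial_deriv j L) * f j) = 0"
    unfolding L assms(2) .
  have "is_form 0 (poly_subst f (partial_deriv j L))" for j
    using is_form_poly_subst[OF c forms] by simp
  from constant_relation_0[OF this rel] have p0: "poly_subst f (partial_deriv j L) = 0" for j .
  have "partial_deriv j L = 0" for j
    using is_form_0_eq_const[OF c[of j]] p0[of j] by (metis const_eq_0_iff poly_subst_const)
  then show ?thesis using L by simp
qed

text \<open>
  The derivatives of \<open>F\<close> are linear forms that vanish at \<open>f\<close>, and there are none but zero.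
\<close>

lemma polar_vector_0:
  assumes "is_form 2 F" "polar_vector f F = 0" shows "F = 0"
proof (rule form_eq_0_if_partial_derivs_0[of 1])
  show F: "is_form (Suc 1) F" using assms(1) by (simp add: numeral_2_eq_2)
  fix j
  show "partial_deriv j F = 0"
    using linear_form_relation_0[OF is_form_partial_deriv[OF F], of j] assms(2)
    by (simp add: polar_vector_def vec_eq_iff)
qed

text \<open>
  By elimination over the field, it is enough that a combination \<open>w\<close> of the \<open>v\<^sub>i\<close> with constant
  coefficients vanishes if \<open>\<phi> w\<close> has constant coefficient zero for every functional \<open>\<phi>\<close>. For such \<open>w\<close>
  the dual basis writes \<open>w\<close> as a combination of elements of \<open>Z\<close>, which have order at least 2, with
  coefficients of order at least 1. So \<open>w\<close> has order at least 3; but its entries are forms of degree 2.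
\<close>

lemma ex_dual_functionals:
  fixes v :: "nat \<Rightarrow> ('n, 'k) mpoly ^ 'm"
  assumes hd: "homological_dimension (*s) (transposed_jacobian_module f) \<le> 1"
    and v: "\<And>i. i < r \<Longrightarrow> v i \<in> Z" "\<And>i j. i < r \<Longrightarrow> is_form 2 (v i $ j)"
    and indep: "\<And>c. (\<Sum>i<r. const (c i) *s v i) = 0 \<Longrightarrow> \<forall>i<r. c i = 0"
  shows "\<exists>\<phi>. \<forall>l<r. hom_on (*s) (*) Z UNIV (\<phi> l) \<and>
    (\<forall>i<r. hcomp 0 (\<phi> l (v i)) = (if i = l then 1 else 0))"
proof -
  define V where "V = {(\<lambda>i. coeff_at (\<phi> (v i)) 0) | \<phi>. hom_on (*s) (*) Z UNIV \<phi>}"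
  have VI: "(\<lambda>i. coeff_at (\<phi> (v i)) 0) \<in> V" if "hom_on (*s) (*) Z UNIV \<phi>" for \<phi>
    using that unfolding V_def by blast
  have "\<exists>\<Delta>. \<Delta> \<notin> {0} \<and> (\<exists>B. \<forall>l<r. B l \<in> V \<and> (\<forall>i<r. B l i = (if i = l then \<Delta> else 0)))"
  proof (rule prime_elimination)
    fix x y a b assume "x \<in> V" "y \<in> V"
    then obtain \<phi> \<psi> where \<phi>: "hom_on (*s) (*) Z UNIV \<phi>" "x = (\<lambda>i. coeff_at (\<phi> (v i)) 0)"
      and \<psi>: "hom_on (*s) (*) Z UNIV \<psi>" "y = (\<lambda>i. coeff_at (\<psi> (v i)) 0)"
      unfolding V_def by blast
    have "hom_on (*s) (*) Z UNIV (\<lambda>z. const a * \<phi> z + const b * \<psi> z)"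
      using \<phi>(1) \<psi>(1) by (simp add: hom_on_def algebra_simps)
    from VI[OF this] show "(\<lambda>i. a * x i + b * y i) \<in> V"
      by (simp add: \<phi>(2) \<psi>(2) lookup_add)
  next
    fix c :: "nat \<Rightarrow> 'k"
    assume c: "\<And>x. x \<in> V \<Longrightarrow> (\<Sum>i<r. c i * x i) \<in> {0}"
    define w where "w = (\<Sum>i<r. const (c i) *s v i)"
    have wZ: "w \<in> Z" unfolding w_def
      by (intro rvec.subspace_sum subspace_differential_syzygies rvec.subspace_scale) (use v in auto)
    have \<phi>w: "order_ge 1 (\<phi> w)" if "hom_on (*s) (*) Z UNIV \<phi>" for \<phi>
    proof (rule order_geI)
      have "\<phi> w = (\<Sum>i<r. \<phi> (const (c i) *s v i))"
        unfolding w_def by (rule hom_on_sum[OF that module_vec subspace_differential_syzygies])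
          (use v(1) in \<open>auto intro!: rvec.subspace_scale subspace_differential_syzygies\<close>)
      also have "\<dots> = (\<Sum>i<r. const (c i) * \<phi> (v i))"
        using v(1) by (intro sum.cong) (auto simp: hom_onD(3)[OF that])
      finally have "coeff_at (\<phi> w) 0 = 0" using c[OF VI[OF that]] by (simp add: lookup_sum)
      then show "hcomp d (\<phi> w) = 0" if "d < 1" for d using that by (simp add: hcomp_zero)
    qed
    have "w \<in> rvec.span {\<phi> w *s y | \<phi> y. hom_on (*s) (*) Z UNIV \<phi> \<and> y \<in> Z}"
      by (rule syzygy_in_trace_span[OF _ differential_syzygies_def wZ])
        (use hd in \<open>simp add: transposed_jacobian_module_def\<close>)
    also have "\<dots> \<subseteq> {u. \<forall>j. order_ge 3 (u $ j)}"
    proof (rule rvec.span_minimal)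
      show "{\<phi> w *s y | \<phi> y. hom_on (*s) (*) Z UNIV \<phi> \<and> y \<in> Z} \<subseteq> {u. \<forall>j. order_ge 3 (u $ j)}"
      proof clarify
        fix \<phi> y j assume "hom_on (*s) (*) Z UNIV \<phi>" "y \<in> Z"
        from order_ge_mult[OF \<phi>w[OF this(1)] order_syzygies[OF this(2)]]
        show "order_ge 3 ((\<phi> w *s y) $ j)" by (simp add: numeral_3_eq_3)
      qed
      show "rvec.subspace {u :: ('n, 'k) mpoly ^ 'm. \<forall>j. order_ge 3 (u $ j)}"
        by (rule rvec.subspaceI) (auto intro: order_ge_add order_ge_mult[OF order_ge_0(1), simplified])
    qed
    finally have "hcomp 2 (w $ j) = 0" for j by (auto intro: hcomp_order_ge)
    moreover have "is_form 2 (w $ j)" for j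
      unfolding w_def using v(2) by (auto intro!: is_form_sum is_form_const_mult)
    ultimately have "w $ j = 0" for j using hcomp_form[of 2 "w $ j" 2] by simp
    then have "w = 0" by (simp add: vec_eq_iff)
    then show "\<forall>i<r. c i \<in> {0}" using indep unfolding w_def by simp
  qed auto
  then obtain \<Delta> B where \<Delta>: "\<Delta> \<noteq> 0" and B: "\<And>l. l < r \<Longrightarrow> B l \<in> V"
    "\<And>l i. l < r \<Longrightarrow> i < r \<Longrightarrow> B l i = (if i = l then \<Delta> else 0)" by blast
  have "\<exists>\<phi>. hom_on (*s) (*) Z UNIV \<phi> \<and> B l = (\<lambda>i. coeff_at (\<phi> (v i)) 0)" if "l < r" for l
    using B(1)[OF that] unfolding V_def by blast
  then obtain \<phi> where \<phi>: "\<And>l. l < r \<Longrightarrow> hom_on (*s) (*) Z UNIV (\<phi> l)"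
    "\<And>l. l < r \<Longrightarrow> B l = (\<lambda>i. coeff_at (\<phi> l (v i)) 0)" by metis
  have "hom_on (*s) (*) Z UNIV (\<lambda>z. const (1 / \<Delta>) * \<phi> l z)" if "l < r" for l
    using \<phi>(1)[OF that] by (simp add: hom_on_def algebra_simps)
  moreover have "hcomp 0 (const (1 / \<Delta>) * \<phi> l (v i)) = (if i = l then 1 else 0)" if "l < r" "i < r" for l i
    using B(2)[OF that] \<phi>(2)[OF that(1)] \<Delta> by (auto simp: hcomp_zero)
  ultimately show ?thesis by (intro exI[of _ "\<lambda>l z. const (1 / \<Delta>) * \<phi> l z"]) blast
qed

end

text \<open>
  Here \<open>F\<close> enumerates a minimal generating set of the relation ideal; minimality enters as linear
  independence over the field.
\<close>

locale quadric_relations = quadric_family f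
  for f :: "'m::finite \<Rightarrow> ('n::finite, 'k::field_char_0) mpoly" +
  fixes F :: "nat \<Rightarrow> ('m, 'k) mpoly" and r :: nat
  assumes F_forms: "\<And>i. i < r \<Longrightarrow> is_form 2 (F i)"
    and F_gen: "relation_ideal f = ideal.span (F ` {..<r})"
    and F_indep: "\<And>c. (\<Sum>i<r. const (c i) * F i) = 0 \<Longrightarrow> \<forall>i<r. c i = 0"
    and hom_dim: "homological_dimension (*s) (transposed_jacobian_module f) \<le> 1"
begin

abbreviation "v i \<equiv> polar_vector f (F i)"

lemma F_relation: "i < r \<Longrightarrow> poly_subst f (F i) = 0"
  using ideal.span_base[of "F i" "F ` {..<r}"] unfolding F_gen[symmetric] relation_ideal_def by blast

lemma v_polar: "i < r \<Longrightarrow> v i \<in> polar_syzygies f"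
  by (rule polar_vector_in_polar) (simp add: relation_ideal_def F_relation)

lemma v_Z: "i < r \<Longrightarrow> v i \<in> Z"
  using v_polar polar_subset_differential_syzygies by blast

lemma v_form: "i < r \<Longrightarrow> is_form 2 (v i $ j)"
  by (rule is_form_polar_vector[OF F_forms])

lemma v_indep_field:
  assumes "(\<Sum>i<r. const (c i) *s v i) = 0" shows "\<forall>i<r. c i = 0"
proof -
  define G where "G = (\<Sum>i<r. const (c i) * F i)"
  have "polar_vector f G = (\<Sum>i<r. const (c i) *s v i)"
    by (simp add: polar_vector_def G_def vec_eq_iff partial_deriv_sum partial_deriv_mult
        poly_subst_sum poly_subst_mult)
  moreover have "is_form 2 G" unfolding G_def using F_forms by (auto intro!: is_form_sum is_form_const_mult)
  ultimately have "G = 0" using polar_vector_0 assms by metis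
  then show ?thesis using F_indep unfolding G_def by blast
qed

lemma polar_eq_span: "polar_syzygies f = rvec.span (v ` {..<r})"
proof
  show "rvec.span (v ` {..<r}) \<subseteq> polar_syzygies f"
    by (rule rvec.span_minimal) (use v_polar in \<open>auto simp: polar_syzygies_def\<close>)
  have "polar_vector f G \<in> rvec.span (v ` {..<r})" if "G \<in> ideal.span (F ` {..<r})" for G
    using that
  proof (induction rule: ideal.span_induct_alt)
    case base
    show ?case by (simp add: polar_vector_def zero_vec_def[symmetric] rvec.span_zero)
  next
    case (step c x y)
    then obtain i where i: "i < r" "x = F i" by auto
    have "polar_vector f (c * x + y) = poly_subst f c *s v i + polar_vector f y"
      using F_relation[OF i(1)]
      by (simp add: i(2) polar_vector_def vec_eq_iff partial_deriv_add partial_deriv_mult poly_subst_add poly_subst_mult)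
    then show ?case using step i by (simp add: rvec.span_add rvec.span_scale rvec.span_base)
  qed
  then show "polar_syzygies f \<subseteq> rvec.span (v ` {..<r})"
    unfolding polar_syzygies_def F_gen by (intro rvec.span_minimal) (auto simp: polar_vector_def)
qed

lemma ex_functionals:
  "\<exists>\<phi>. \<forall>l<r. hom_on (*s) (*) Z UNIV (\<phi> l) \<and>
    (\<forall>i<r. hcomp 0 (\<phi> l (v i)) = (if i = l then 1 else 0))"
  by (rule ex_dual_functionals[OF hom_dim v_Z v_form v_indep_field])

text \<open>
  Apply a dual functional and compare the coefficients of lowest degree.
\<close>

lemma v_form_combination_0:
  assumes "\<And>i. i < r \<Longrightarrow> is_form d (a i)" and a: "(\<Sum>i<r. a i *s v i) = 0"
  shows "\<forall>i<r. a i = 0"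
proof (intro allI impI)
  fix l assume l: "l < r"
  obtain \<phi> where \<phi>: "\<And>l. l < r \<Longrightarrow> hom_on (*s) (*) Z UNIV (\<phi> l)"
    "\<And>l i. l < r \<Longrightarrow> i < r \<Longrightarrow> hcomp 0 (\<phi> l (v i)) = (if i = l then 1 else 0)"
    using ex_functionals by blast
  have "0 = \<phi> l (\<Sum>i<r. a i *s v i)"
    unfolding a by (simp add: hom_on_0[OF \<phi>(1)[OF l]] differential_syzygies_def)
  also have "\<dots> = (\<Sum>i<r. a i * \<phi> l (v i))"
    by (rule hom_on_combination[OF \<phi>(1)[OF l] subspace_differential_syzygies v_Z])
  finally have "hcomp d (\<Sum>i<r. a i * \<phi> l (v i)) = hcomp d 0" by (simp only:)
  then show "a l = 0" by (simp add: hcomp_dual_combination[OF l \<phi>(2)[OF l] assms(1)])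
qed

lemma v_indep:
  assumes a: "(\<Sum>i<r. a i *s v i) = 0" and "i < r"
  shows "a i = 0"
proof (rule hcomp_eqI)
  fix d
  have "(\<Sum>i<r. hcomp d (a i) *s v i) $ j = hcomp (d + 2) ((\<Sum>i<r. a i *s v i) $ j)" for j
    by (simp add: hcomp_sum hcomp_mult_form[OF v_form])
  then have "(\<Sum>i<r. hcomp d (a i) *s v i) = 0" using a by (simp add: vec_eq_iff)
  from v_form_combination_0[OF is_form_hcomp this] have "hcomp d (a i) = 0"
    using \<open>i < r\<close> by blast
  then show "hcomp d (a i) = hcomp d 0" by simp
qed

text \<open>
  Subtract from \<open>z\<close> the combination \<open>y\<close> of the \<open>v\<^sub>i\<close> that has the same lowest coefficients under the
  dual functionals. A nonzero multiple of the difference is again a combination of the \<open>v\<^sub>i\<close>, by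
  equality of ranks. Its coefficients can be read off from its lowest coefficients, which are zero,
  so the difference itself vanishes.
\<close>

lemma form_syzygy_in_polar:
  assumes z: "z \<in> Z" "\<And>j. is_form (e + 2) (z $ j)"
  shows "z \<in> polar_syzygies f"
proof -
  obtain \<phi> where \<phi>: "\<And>l. l < r \<Longrightarrow> hom_on (*s) (*) Z UNIV (\<phi> l)"
    "\<And>l i. l < r \<Longrightarrow> i < r \<Longrightarrow> hcomp 0 (\<phi> l (v i)) = (if i = l then 1 else 0)"
    using ex_functionals by blast
  note sub = subspace_differential_syzygies
  define b where "b i = hcomp e (\<phi> i z)" for i
  define y where "y = (\<Sum>i<r. b i *s v i)"
  have y: "y \<in> polar_syzygies f"
    unfolding y_def polar_eq_span by (intro rvec.span_sum rvec.span_scale rvec.span_base) auto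
  then have yZ: "y \<in> Z" using polar_subset_differential_syzygies by blast
  define z' where "z' = z - y"
  have z'Z: "z' \<in> Z" unfolding z'_def by (intro rvec.subspace_diff sub z yZ)
  have z'_form: "is_form (e + 2) (z' $ j)" for j
    unfolding z'_def y_def using is_form_mult[OF _ v_form, of e "b _"] z(2)
    by (auto simp: b_def intro!: is_form_diff is_form_sum)
  have \<phi>z': "hcomp e (\<phi> l z') = 0" if l: "l < r" for l
  proof -
    have "\<phi> l y = (\<Sum>i<r. b i * \<phi> l (v i))"
      unfolding y_def by (rule hom_on_combination[OF \<phi>(1)[OF l] sub v_Z])
    then have "hcomp e (\<phi> l y) = b l"
      using hcomp_dual_combination[OF l \<phi>(2)[OF l], of e b] by (simp add: b_def)
    then show ?thesis
      unfolding z'_def hom_on_diff[OF \<phi>(1)[OF l] module_vec sub z(1) yZ] by (simp add: hcomp_diff b_def)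
  qed
  obtain c0 where c0: "c0 \<noteq> 0" "c0 *s z' \<in> polar_syzygies f"
    using polar_syzygies_full_rank[OF z'Z] by blast
  obtain d where d: "hcomp d c0 \<noteq> 0" using ex_hcomp_nonzero[OF c0(1)] by blast
  \<comment> \<open>The multiplier may be replaced by one of its homogeneous components, because \<open>z'\<close> is homogeneous.\<close>
  define c where "c = hcomp d c0"
  obtain a0 where a0: "c0 *s z' = (\<Sum>i<r. a0 i *s v i)"
    using c0(2) rvec.span_image_coordinates[of "{..<r}"] unfolding polar_eq_span by blast
  define a where "a i = hcomp (d + e) (a0 i)" for i
  have cz': "c *s z' = (\<Sum>i<r. a i *s v i)"
  proof -
    have "(c *s z') $ j = (\<Sum>i<r. a i *s v i) $ j" for j
    proof -
      have "(c *s z') $ j = hcomp (d + (e + 2)) ((c0 *s z') $ j)"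
        by (simp add: c_def hcomp_mult_form[OF z'_form])
      also have "\<dots> = (\<Sum>i<r. a i *s v i) $ j"
        unfolding a0 by (simp add: hcomp_sum a_def hcomp_mult_form[OF v_form])
      finally show ?thesis .
    qed
    then show ?thesis by (simp only: vec_eq_iff) blast
  qed
  have "a l = 0" if l: "l < r" for l
  proof -
    have "\<phi> l z' * c = (\<Sum>i<r. a i * \<phi> l (v i))"
      using hom_onD(3)[OF \<phi>(1)[OF l] z'Z, of c] hom_on_combination[OF \<phi>(1)[OF l] sub v_Z, where a = a]
      unfolding cz' by (simp add: mult.commute)
    then have "a l = hcomp (d + e) (\<phi> l z' * c)"
      using hcomp_dual_combination[OF l \<phi>(2)[OF l], of "d + e" a] by (simp add: a_def)
    also have "\<dots> = 0" using \<phi>z'[OF l] by (simp add: c_def hcomp_mult_form[of d])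
    finally show ?thesis .
  qed
  then have "c *s z' = 0" unfolding cz' by simp
  then have "z' = 0" using d by (simp add: c_def vec_eq_iff)
  then show ?thesis using y by (simp add: z'_def)
qed

theorem polarizable: "polarizable f"
  unfolding polarizable_def
proof
  show "polar_syzygies f \<subseteq> Z" by (rule polar_subset_differential_syzygies)
  show "Z \<subseteq> polar_syzygies f"
  proof
    fix z assume z: "z \<in> Z"
    define D where "D = (\<Union>j. exp_deg ` Poly_Mapping.keys (z $ j))"
    have "z $ j = (\<Sum>d\<in>D. hcomp d (z $ j))" for j
    proof -
      have "hcomp d (z $ j) = 0" if "d \<notin> exp_deg ` Poly_Mapping.keys (z $ j)" for d
        using that by (intro poly_mapping_eqI) (auto simp: lookup_hcomp in_keys_iff)
      then have "(\<Sum>d\<in>D. hcomp d (z $ j)) = (\<Sum>d\<in>exp_deg ` Poly_Mapping.keys (z $ j). hcomp d (z $ j))"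
        by (intro sum.mono_neutral_right) (auto simp: D_def)
      then show ?thesis using sum_hcomp[of "z $ j"] by simp
    qed
    from this[symmetric] have sum: "(\<Sum>d\<in>D. vec_hcomp d z) = z"
      by (simp add: vec_eq_iff vec_hcomp_def)
    have comp: "vec_hcomp d z \<in> polar_syzygies f" for d
    proof (cases "2 \<le> d")
      case True
      then have "d - 2 + 2 = d" by simp
      then show ?thesis
        using form_syzygy_in_polar[OF vec_hcomp_in_Z[OF z, of d], of "d - 2"] by (simp add: vec_hcomp_def)
    next
      case False
      then have "vec_hcomp d z = 0"
        using hcomp_order_ge[OF order_syzygies[OF z], of d] by (simp add: vec_hcomp_def vec_eq_iff)
      then show ?thesis by (simp add: polar_syzygies_def rvec.span_zero)
    qed
    have "(\<Sum>d\<in>D. vec_hcomp d z) \<in> polar_syzygies f"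
      unfolding polar_syzygies_def
      by (rule rvec.span_sum) (rule comp[unfolded polar_syzygies_def])
    then show "z \<in> polar_syzygies f" unfolding sum .
  qed
qed

text \<open>
  Linear independence of the \<open>v\<^sub>i\<close> is independence of the gradients of the \<open>F\<^sub>i\<close> modulo the relation
  ideal, so elimination applies to the values of all derivations of the polynomial ring at the \<open>F\<^sub>i\<close>.
\<close>

lemma ex_dual_derivations:
  obtains \<delta> \<Delta> where "dual_derivations F r \<delta> \<Delta>"
proof -
  define der where "der \<delta> \<longleftrightarrow> (\<forall>x y. \<delta> (x + y) = \<delta> x + \<delta> y \<and> \<delta> (x * y) = \<delta> x * y + x * \<delta> y)"
    for \<delta> :: "('m, 'k) mpoly \<Rightarrow> ('m, 'k) mpoly"
  define V where "V = {(\<lambda>i. \<delta> (F i)) | \<delta>. der \<delta>}"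
  have VI: "(\<lambda>i. \<delta> (F i)) \<in> V" if "der \<delta>" for \<delta> using that unfolding V_def by blast
  have "\<exists>\<Delta>. \<Delta> \<notin> relation_ideal f \<and> (\<exists>B. \<forall>l<r. B l \<in> V \<and> (\<forall>i<r. B l i = (if i = l then \<Delta> else 0)))"
  proof (rule prime_elimination)
    fix x y a b assume "x \<in> V" "y \<in> V"
    then obtain \<delta> \<delta>' where \<delta>: "der \<delta>" "x = (\<lambda>i. \<delta> (F i))" and \<delta>': "der \<delta>'" "y = (\<lambda>i. \<delta>' (F i))"
      unfolding V_def by blast
    have "der (\<lambda>p. a * \<delta> p + b * \<delta>' p)"
      using \<delta>(1) \<delta>'(1) by (simp add: der_def algebra_simps)
    from VI[OF this] show "(\<lambda>i. a * x i + b * y i) \<in> V" by (simp add: \<delta>(2) \<delta>'(2))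
  next
    fix c :: "nat \<Rightarrow> ('m, 'k) mpoly"
    assume c: "\<And>x. x \<in> V \<Longrightarrow> (\<Sum>i<r. c i * x i) \<in> relation_ideal f"
    have "der (partial_deriv j)" for j by (simp add: der_def partial_deriv_add partial_deriv_mult)
    from c[OF VI[OF this]] have "(\<Sum>i<r. poly_subst f (c i) *s v i) = 0"
      by (simp add: relation_ideal_def poly_subst_sum poly_subst_mult polar_vector_def vec_eq_iff)
    then show "\<forall>i<r. c i \<in> relation_ideal f"
      using v_indep[of "\<lambda>i. poly_subst f (c i)"] by (simp add: relation_ideal_def)
  qed (use relation_ideal_prime[of _ _ f] in \<open>auto simp: relation_ideal_def\<close>)
  then obtain \<Delta> B where \<Delta>: "\<Delta> \<notin> relation_ideal f" and B: "\<And>l. l < r \<Longrightarrow> B l \<in> V"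
    "\<And>l i. l < r \<Longrightarrow> i < r \<Longrightarrow> B l i = (if i = l then \<Delta> else 0)" by blast
  have "\<exists>\<delta>. der \<delta> \<and> B l = (\<lambda>i. \<delta> (F i))" if "l < r" for l
    using B(1)[OF that] unfolding V_def by blast
  then obtain \<delta> where \<delta>: "\<And>l. l < r \<Longrightarrow> der (\<delta> l)" "\<And>l. l < r \<Longrightarrow> B l = (\<lambda>i. \<delta> l (F i))" by metis
  have "dual_derivations F r \<delta> \<Delta>"
  proof
    show "\<delta> l (F i) = (if i = l then \<Delta> else 0)" if "l < r" "i < r" for l i
      using B(2)[OF that] \<delta>(2)[OF that(1)] by simp
    show "u \<in> ideal.span (F ` {..<r})" if "\<Delta> * u \<in> ideal.span (F ` {..<r})" for u
      using that \<Delta> relation_ideal_prime unfolding F_gen[symmetric] by blast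
    show "\<exists>v. of_nat (Suc n) * v = (1 :: ('m, 'k) mpoly)" for n
      by (rule exI[of _ "const (1 / of_nat (Suc n))"])
        (simp only: const_of_nat[symmetric] const_mult[symmetric], simp del: of_nat_Suc)
  qed (use \<delta>(1) in \<open>auto simp: der_def\<close>)
  then show thesis by (rule that)
qed

text \<open>
  In degree \<open>e\<close> the power \<open>P\<^sup>e\<^sup>+\<^sup>1\<close> is zero. So an element of all \<open>J\<^sub>i + P\<^sup>n\<close> has its homogeneous components
  in \<open>J\<^sub>i\<close>.
\<close>

theorem regular_sequence_F: "regular_sequence (map F [0..<r])"
proof -
  obtain \<delta> \<Delta> where "dual_derivations F r \<delta> \<Delta>" by (rule ex_dual_derivations)
  then interpret dual_derivations F r \<delta> \<Delta> .
  have order_Ppow: "order_ge n x" if "x \<in> Ppow n" for n x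
    using that
  proof (induction n arbitrary: x)
    case (Suc n)
    then obtain u where u: "x = (\<Sum>l<r. F l * u l)" "\<forall>l<r. u l \<in> Ppow n" by auto
    have "order_ge (1 + n) (F l * u l)" if "l < r" for l
      using Suc.IH u(2) that by (intro order_ge_mult order_ge_form[OF F_forms[OF that]]) auto
    then show ?case unfolding u(1) by (intro order_ge_sum) auto
  qed simp
  have cancel: "h \<in> ideal.span (F ` {..<i})" if i: "i < r" and h: "F i * h \<in> ideal.span (F ` {..<i})" for i h
  proof -
    have "hcomp e h \<in> ideal.span (F ` {..<i})" for e
    proof -
      obtain a b where ab: "h = a + b" "a \<in> ideal.span (F ` {..<i})" "b \<in> Ppow (Suc e)"
        using F_cancel[OF i h, of "Suc e"] unfolding K_def by blast
      have "hcomp e h = hcomp e a"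
        using hcomp_order_ge[OF order_Ppow[OF ab(3)], of e] by (simp add: ab(1) hcomp_add)
      then show ?thesis
        using hcomp_homogeneous_ideal[of "{..<i}" 2 F a e] F_forms i ab(2) by auto
    qed
    then show ?thesis by (subst sum_hcomp) (rule ideal.span_sum)
  qed
  have take: "set (take i (map F [0..<r])) = F ` {..<i}" if "i \<le> r" for i
    using that by (auto simp: take_map)
  have "gen_ideal (set (map F [0..<r])) = relation_ideal f"
    by (simp add: gen_ideal_def F_gen atLeast0LessThan)
  moreover have "1 \<notin> relation_ideal f" by (simp add: relation_ideal_def)
  ultimately have "gen_ideal (set (map F [0..<r])) \<noteq> UNIV" by blast
  then show ?thesis
    unfolding regular_sequence_def using cancel by (simp add: take gen_ideal_def)
qed

end

theorem proposition4p4: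
  fixes f :: "'m::finite \<Rightarrow> ('n::finite, 'k::field_char_0) mpoly"
  assumes forms: "\<And>j. is_form 2 (f j)"
    and lin_indep: "\<And>c :: 'm \<Rightarrow> 'k. (\<Sum>j\<in>UNIV. const (c j) * f j) = 0 \<Longrightarrow> \<forall>j. c j = 0"
    and quadrics: "\<exists>G. minimally_generates G (relation_ideal f) \<and> (\<forall>F\<in>G. is_form 2 F)"
    and hom_dim: "homological_dimension (*s) (transposed_jacobian_module f) \<le> 1"
  shows "polarizable f \<and>
    (\<exists>gs. regular_sequence gs \<and> relation_ideal f = gen_ideal (set gs))"
proof -
  obtain G where G: "minimally_generates G (relation_ideal f)" "\<forall>F\<in>G. is_form 2 F"
    using quadrics by blast
  have "finite G" using G(1) by (simp add: minimally_generates_def)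
  then obtain F where F: "bij_betw F {..<card G} G"
    using ex_bij_betw_nat_finite[of G] by (auto simp: atLeast0LessThan)
  have FG: "F ` {..<card G} = G" using F by (simp add: bij_betw_def)
  interpret quadric_relations f F "card G"
  proof
    show "is_form 2 (F i)" if "i < card G" for i using G(2) FG that by blast
    show "relation_ideal f = ideal.span (F ` {..<card G})"
      unfolding FG using G(1) by (simp add: minimally_generates_def gen_ideal_def)
    show "\<forall>i<card G. c i = 0" if "(\<Sum>i<card G. const (c i) * F i) = 0" for c
      using minimal_generators_independent[OF G(1) F that] by blast
  qed (use forms lin_indep hom_dim in auto)
  have "relation_ideal f = gen_ideal (set (map F [0..<card G]))"
    unfolding gen_ideal_def F_gen by (simp add: atLeast0LessThan)
  then show ?thesis using polarizable regular_sequence_F by blast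
qed

end
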